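(* Let $\mathcal{D}$ be a well generated triangulated category, $\omega$ a partial silting object in $\mathcal{D}$, and consider the associated recollement with outer terms $\mathcal{Y}=\omega^{\perp_{\mathbb{Z}}}$ and $\mathcal{X}=\mathrm{Loc}(\omega)$ and functors $i^*,i_*,i^!$, $j_!,j^*,j_*$, where $i_*$ and $j_!$ are the inclusions. Let $\sigma$ be a silting object in $\mathcal{Y}$. Assume that $j_*\omega$ has an $\mathrm{add}(i_*\sigma[1])$-preenvelope $\alpha\colon j_*\omega\to i_*\sigma^I[1]$ for a finite set $I$, and that (1) $(i_*\sigma)^{\perp_{>0}}$ is closed under coproducts in $\mathcal{D}$; (2) $\mathrm{Hom}_{\mathcal{D}}(j_*\omega,i_*\sigma[k])=0$ for all $k\ge 2$; (3) $j_*\omega$ is compact in $\mathcal{D}$. Let $\tilde\sigma$ be the cocone of $\alpha$ and let $\rho=\tilde\sigma\oplus i_*\sigma$ (a silting object of $\mathcal{D}$). By (1), the recollement has a lower adjacent recollement, i.e. $j_*$ has a right adjoint $j^{\#}\colon\mathcal{D}\to\mathcal{X}$ and $i^!$ has a right adjoint $i_{\#}\colon\mathcal{Y}\to\mathcal{D}$, and there is a recollement $\mathcal{X}\xrightarrow{j_*}\mathcal{D}\xrightarrow{i^!}\mathcal{Y}$ with functors $j^*,j_*,j^{\#}$ and $i_*,i^!,i_{\#}$. Let $(\mathcal{X}',\mathcal{X}'')=(\omega^{\perp_{>0}},\omega^{\perp_{\le 0}})$ and $(\mathcal{Y}',\mathcal{Y}'')=(\sigma^{\perp_{>0}},\sigma^{\perp_{\le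 0}})$ be the t-structures associated to $\omega$ in $\mathcal{X}$ and to $\sigma$ in $\mathcal{Y}$, and let $(\mathcal{D}',\mathcal{D}'')$ be the t-structure in $\mathcal{D}$ glued from them along the lower adjacent recollement: $$\mathcal{D}'=\{Z\in\mathcal{D} : j^*Z\in\mathcal{X}',\ i^!Z\in\mathcal{Y}'\},\qquad \mathcal{D}''=\{Z\in\mathcal{D} : j^{\#}Z\in\mathcal{X}'',\ i^!Z\in\mathcal{Y}''\}.$$ Then the t-structures $(\rho^{\perp_{>0}},\rho^{\perp_{\le 0}})$ and $(\mathcal{D}',\mathcal{D}'')$ in $\mathcal{D}$ coincide.
   Context: Well generated is meant in the sense of Neeman/Krause. For an object $X$ of a triangulated category $\mathcal{T}$ and a set $I$ of integers (written e.g. $>0$, $\le 0$, $\mathbb{Z}$), $X^{\perp_I}=\{Y\in\mathcal{T} : \mathrm{Hom}_{\mathcal{T}}(X,Y[i])=0 \text{ for all } i\in I\}$; orthogonals of $\omega$ and $\sigma$ defining the t-structures are taken in $\mathcal{X}$ and $\mathcal{Y}$ respectively, those of $\rho$ in $\mathcal{D}$. $\mathrm{Loc}(\omega)$ is the smallest triangulated subcategory containing $\omega$ and closed under coproducts; $\mathrm{add}(X)$ is the closure of $X$ under finite coproducts and summands. An object $M$ is compact if $\mathrm{Hom}(M,-)$ commutes with coproducts. A map $\alpha\colon M\to N$ is a $\mathcal{C}$-preenvelope if $N\in\mathcal{C}$ and $\mathrm{Hom}(\alpha,C)$ is surjective for all $C\in\mathcal{C}$. A torsion pair $(\mathcal{U},\mathcal{V})$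 is a pair of full subcategories closed under summands with $\mathrm{Hom}(\mathcal{U},\mathcal{V})=0$ such that every object $X$ lies in a triangle $U\to X\to V\to U[1]$ with $U\in\mathcal{U}$, $V\in\mathcal{V}$; it is a t-structure if $\mathcal{U}$ is closed under positive shifts and extensions. An object $\sigma$ is silting if $(\sigma^{\perp_{>0}},\sigma^{\perp_{\le 0}})$ is a t-structure. In a well generated category, $\omega$ is partial silting if $\omega\in\omega^{\perp_{>0}}$ and $\omega^{\perp_{>0}}$ is closed under coproducts. For $\omega$ partial silting there is a recollement $\omega^{\perp_{\mathbb{Z}}} \xrightarrow{i_*} \mathcal{D} \xrightarrow{j^*} \mathrm{Loc}(\omega)$ with $i_*$ and $j_!\colon\mathrm{Loc}(\omega)\to\mathcal{D}$ the inclusions, adjoint pairs $(i^*,i_* ),(i_*,i^!),(j_!,j^* ),(j^*,j_* )$, with $i_*,j_!,j_*$ fully faithful and $i^!j_*=0$; $\omega$ is silting in $\mathrm{Loc}(\omega)$. *)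

theory Defs
  imports "HOL-Algebra.FiniteProduct" "HOL-Algebra.Product_Groups"
begin

unbundle cardinal_syntax

text \<open>
  Smallness is measured by a cardinal \<open>\<kappa>\<close>: a set is small if it has fewer than \<open>\<kappa>\<close> elements, and a
  category may have arbitrarily large classes (HOL sets) of objects and arrows. The cardinal is
  only required to be regular and uncountable. Sets in the sense of a Grothendieck universe are the
  case of a strongly inaccessible \<open>\<kappa>\<close>. Inaccessibility is not required: HOL cannot
  exhibit such a cardinal. Up to bijection, every small set is a subset of the type underlying
  \<open>\<kappa>\<close>, so that small families are indexed by subsets of that type.
\<close>

definition size_cardinal :: "'u rel \<Rightarrow> bool" where
  "size_cardinal \<kappa> \<longleftrightarrow> Card_order \<kappa> \<and> natLeq <o \<kappa> \<and> regularCard \<kappa>"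

definition small :: "'u rel \<Rightarrow> 'a set \<Rightarrow> bool" where
  "small \<kappa> A \<longleftrightarrow> |A| <o \<kappa>"


section \<open>Categories and additive categories\<close>

record ('o, 'm) category =
  Ob :: "'o set"
  Ar :: "'m set"
  Dom :: "'m \<Rightarrow> 'o"
  Cod :: "'m \<Rightarrow> 'o"
  Id :: "'o \<Rightarrow> 'm"
  Comp :: "'m \<Rightarrow> 'm \<Rightarrow> 'm" (infixl "\<cdot>\<index>" 70)

definition Hom :: "('o, 'm, 'z) category_scheme \<Rightarrow> 'o \<Rightarrow> 'o \<Rightarrow> 'm set" where
  "Hom C A B = {f \<in> Ar C. Dom C f = A \<and> Cod C f = B}"

locale category =
  fixes C :: "('o, 'm, 'z) category_scheme" (structure)
  assumes Dom_in_Ob: "f \<in> Ar C \<Longrightarrow> Dom C f \<in> Ob C"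
    and Cod_in_Ob: "f \<in> Ar C \<Longrightarrow> Cod C f \<in> Ob C"
    and Id_in_Hom: "A \<in> Ob C \<Longrightarrow> Id C A \<in> Hom C A A"
    and Comp_in_Hom: "f \<in> Hom C A B \<Longrightarrow> g \<in> Hom C B D \<Longrightarrow> g \<cdot> f \<in> Hom C A D"
    and Id_left: "f \<in> Hom C A B \<Longrightarrow> Id C B \<cdot> f = f"
    and Id_right: "f \<in> Hom C A B \<Longrightarrow> f \<cdot> Id C A = f"
    and Comp_assoc: "f \<in> Hom C A B \<Longrightarrow> g \<in> Hom C B D \<Longrightarrow> h \<in> Hom C D E
      \<Longrightarrow> h \<cdot> (g \<cdot> f) = (h \<cdot> g) \<cdot> f"

definition iso_arrow :: "('o, 'm, 'z) category_scheme \<Rightarrow> 'm \<Rightarrow> bool" where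
  "iso_arrow C f \<longleftrightarrow> f \<in> Ar C \<and> (\<exists>g \<in> Hom C (Cod C f) (Dom C f).
     g \<cdot>\<^bsub>C\<^esub> f = Id C (Dom C f) \<and> f \<cdot>\<^bsub>C\<^esub> g = Id C (Cod C f))"

definition isomorphic :: "('o, 'm, 'z) category_scheme \<Rightarrow> 'o \<Rightarrow> 'o \<Rightarrow> bool" where
  "isomorphic C A B \<longleftrightarrow> (\<exists>f \<in> Hom C A B. iso_arrow C f)"

definition is_coproduct ::
  "('o, 'm, 'z) category_scheme \<Rightarrow> 'i set \<Rightarrow> ('i \<Rightarrow> 'o) \<Rightarrow> 'o \<Rightarrow> ('i \<Rightarrow> 'm) \<Rightarrow> bool" where
  "is_coproduct C I A S \<iota> \<longleftrightarrow> S \<in> Ob C \<and> (\<forall>i\<in>I. \<iota> i \<in> Hom C (A i) S) \<and>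
     (\<forall>T \<in> Ob C. \<forall>f. (\<forall>i\<in>I. f i \<in> Hom C (A i) T) \<longrightarrow>
        (\<exists>!h. h \<in> Hom C S T \<and> (\<forall>i\<in>I. h \<cdot>\<^bsub>C\<^esub> \<iota> i = f i)))"

definition is_product ::
  "('o, 'm, 'z) category_scheme \<Rightarrow> 'i set \<Rightarrow> ('i \<Rightarrow> 'o) \<Rightarrow> 'o \<Rightarrow> ('i \<Rightarrow> 'm) \<Rightarrow> bool" where
  "is_product C I A P \<pi> \<longleftrightarrow> P \<in> Ob C \<and> (\<forall>i\<in>I. \<pi> i \<in> Hom C P (A i)) \<and>
     (\<forall>T \<in> Ob C. \<forall>f. (\<forall>i\<in>I. f i \<in> Hom C T (A i)) \<longrightarrow>
        (\<exists>!h. h \<in> Hom C T P \<and> (\<forall>i\<in>I. \<pi> i \<cdot>\<^bsub>C\<^esub> h = f i)))"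

definition has_small_coproducts :: "'u rel \<Rightarrow> ('o, 'm, 'z) category_scheme \<Rightarrow> bool" where
  "has_small_coproducts \<kappa> C \<longleftrightarrow> (\<forall>(I :: 'u set) A. small \<kappa> I \<and> (\<forall>i\<in>I. A i \<in> Ob C) \<longrightarrow>
     (\<exists>S \<iota>. is_coproduct C I A S \<iota>))"

definition closed_under_coproducts ::
  "'u rel \<Rightarrow> ('o, 'm, 'z) category_scheme \<Rightarrow> 'o set \<Rightarrow> bool" where
  "closed_under_coproducts \<kappa> C \<S> \<longleftrightarrow> (\<forall>(I :: 'u set) A S \<iota>.
     small \<kappa> I \<and> (\<forall>i\<in>I. A i \<in> \<S>) \<and> is_coproduct C I A S \<iota> \<longrightarrow> S \<in> \<S>)"

definition locally_small :: "'u rel \<Rightarrow> ('o, 'm, 'z) category_scheme \<Rightarrow> bool" where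
  "locally_small \<kappa> C \<longleftrightarrow> (\<forall>A\<in>Ob C. \<forall>B\<in>Ob C. small \<kappa> (Hom C A B))"

definition preenvelope ::
  "('o, 'm, 'z) category_scheme \<Rightarrow> 'o set \<Rightarrow> 'o \<Rightarrow> 'o \<Rightarrow> 'm \<Rightarrow> bool" where
  "preenvelope C \<S> M N \<alpha> \<longleftrightarrow> \<alpha> \<in> Hom C M N \<and> N \<in> \<S> \<and>
     (\<forall>B\<in>\<S>. \<forall>f \<in> Hom C M B. \<exists>g \<in> Hom C N B. g \<cdot>\<^bsub>C\<^esub> \<alpha> = f)"

record ('o, 'm) precategory = "('o, 'm) category" +
  Add :: "'m \<Rightarrow> 'm \<Rightarrow> 'm"
  Zero :: "'o \<Rightarrow> 'o \<Rightarrow> 'm"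

definition hom_group :: "('o, 'm, 'z) precategory_scheme \<Rightarrow> 'o \<Rightarrow> 'o \<Rightarrow> 'm monoid" where
  "hom_group C A B = \<lparr>carrier = Hom C A B, mult = Add C, one = Zero C A B\<rparr>"

definition Neg :: "('o, 'm, 'z) precategory_scheme \<Rightarrow> 'm \<Rightarrow> 'm" where
  "Neg C f = inv\<^bsub>hom_group C (Dom C f) (Cod C f)\<^esub> f"

definition hom_vanishes :: "('o, 'm, 'z) precategory_scheme \<Rightarrow> 'o \<Rightarrow> 'o \<Rightarrow> bool" where
  "hom_vanishes C A B \<longleftrightarrow> Hom C A B = {Zero C A B}"

definition is_zero :: "('o, 'm, 'z) precategory_scheme \<Rightarrow> 'o \<Rightarrow> bool" where
  "is_zero C A \<longleftrightarrow> A \<in> Ob C \<and> (\<forall>B\<in>Ob C. hom_vanishes C A B \<and> hom_vanishes C B A)"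

definition direct_sum :: "('o, 'm, 'z) precategory_scheme \<Rightarrow> 'o \<Rightarrow> 'o \<Rightarrow> 'o \<Rightarrow> bool" where
  "direct_sum C A B S \<longleftrightarrow> (\<exists>\<iota>\<^sub>1 \<in> Hom C A S. \<exists>\<iota>\<^sub>2 \<in> Hom C B S. \<exists>\<pi>\<^sub>1 \<in> Hom C S A. \<exists>\<pi>\<^sub>2 \<in> Hom C S B.
     \<pi>\<^sub>1 \<cdot>\<^bsub>C\<^esub> \<iota>\<^sub>1 = Id C A \<and> \<pi>\<^sub>2 \<cdot>\<^bsub>C\<^esub> \<iota>\<^sub>2 = Id C B \<and>
     \<pi>\<^sub>1 \<cdot>\<^bsub>C\<^esub> \<iota>\<^sub>2 = Zero C B A \<and> \<pi>\<^sub>2 \<cdot>\<^bsub>C\<^esub> \<iota>\<^sub>1 = Zero C A B \<and>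
     Add C (\<iota>\<^sub>1 \<cdot>\<^bsub>C\<^esub> \<pi>\<^sub>1) (\<iota>\<^sub>2 \<cdot>\<^bsub>C\<^esub> \<pi>\<^sub>2) = Id C S)"

locale additive_category = category C
  for C :: "('o, 'm, 'z) precategory_scheme" (structure) +
  assumes hom_comm_group: "A \<in> Ob C \<Longrightarrow> B \<in> Ob C \<Longrightarrow> comm_group (hom_group C A B)"
    and Comp_Add_right: "f \<in> Hom C A B \<Longrightarrow> f' \<in> Hom C A B \<Longrightarrow> g \<in> Hom C B D
      \<Longrightarrow> g \<cdot> Add C f f' = Add C (g \<cdot> f) (g \<cdot> f')"
    and Comp_Add_left: "f \<in> Hom C A B \<Longrightarrow> g \<in> Hom C B D \<Longrightarrow> g' \<in> Hom C B D
      \<Longrightarrow> Add C g g' \<cdot> f = Add C (g \<cdot> f) (g' \<cdot> f)"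
    and ex_zero: "\<exists>Z. is_zero C Z"
    and ex_direct_sum: "A \<in> Ob C \<Longrightarrow> B \<in> Ob C \<Longrightarrow> \<exists>S. direct_sum C A B S"

definition closed_under_summands ::
  "('o, 'm, 'z) precategory_scheme \<Rightarrow> 'o set \<Rightarrow> bool" where
  "closed_under_summands C \<S> \<longleftrightarrow> (\<forall>A\<in>Ob C. \<forall>B\<in>Ob C. \<forall>S\<in>\<S>. direct_sum C A B S \<longrightarrow> A \<in> \<S>)"

definition closed_under_finite_coproducts ::
  "('o, 'm, 'z) category_scheme \<Rightarrow> 'o set \<Rightarrow> bool" where
  "closed_under_finite_coproducts C \<S> \<longleftrightarrow> (\<forall>(I :: nat set) A S \<iota>.
     finite I \<and> (\<forall>i\<in>I. A i \<in> \<S>) \<and> is_coproduct C I A S \<iota> \<longrightarrow> S \<in> \<S>)"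

definition add_closure :: "('o, 'm, 'z) precategory_scheme \<Rightarrow> 'o \<Rightarrow> 'o set" where
  "add_closure C M = \<Inter>{\<S>. \<S> \<subseteq> Ob C \<and> M \<in> \<S> \<and> closed_under_finite_coproducts C \<S> \<and>
     closed_under_summands C \<S>}"

text \<open>
  \<open>M\<close> is compact if the canonical map from the direct sum of the groups \<open>Hom(M, A\<^sub>i)\<close> to
  \<open>Hom(M, \<Coprod>A\<^sub>i)\<close> is an isomorphism. The sum of the finitely many nonzero \<open>\<iota>\<^sub>i \<circ> f\<^sub>i\<close> is a
  \<^const>\<open>finprod\<close> because \<^const>\<open>hom_group\<close> is written multiplicatively.
\<close>

definition compact_object :: "'u rel \<Rightarrow> ('o, 'm, 'z) precategory_scheme \<Rightarrow> 'o \<Rightarrow> bool" where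
  "compact_object \<kappa> C M \<longleftrightarrow> M \<in> Ob C \<and> (\<forall>(I :: 'u set) A S \<iota>.
     small \<kappa> I \<and> (\<forall>i\<in>I. A i \<in> Ob C) \<and> is_coproduct C I A S \<iota> \<longrightarrow>
     (\<lambda>f. finprod (hom_group C M S) (\<lambda>i. \<iota> i \<cdot>\<^bsub>C\<^esub> f i) {i\<in>I. f i \<noteq> Zero C M (A i)})
       \<in> iso (sum_group I (\<lambda>i. hom_group C M (A i))) (hom_group C M S))"


section \<open>Triangulated categories\<close>

text \<open>
  The shift \<open>Sh\<close> (on objects) and \<open>ShA\<close> (on arrows) is an automorphism, and a triangle
  \<open>A \<rightarrow> B \<rightarrow> D \<rightarrow> A[1]\<close> is given by its three arrows.
\<close>

record ('o, 'm) tricategory = "('o, 'm) precategory" +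
  Sh :: "'o \<Rightarrow> 'o"
  ShA :: "'m \<Rightarrow> 'm"
  Tri :: "('m \<times> 'm \<times> 'm) set"

definition shift :: "('o, 'm, 'z) tricategory_scheme \<Rightarrow> int \<Rightarrow> 'o \<Rightarrow> 'o" where
  "shift C k A = (if k \<ge> 0 then (Sh C ^^ nat k) A
                  else (inv_into (Ob C) (Sh C) ^^ nat (- k)) A)"

definition candidate_triangle ::
  "('o, 'm, 'z) tricategory_scheme \<Rightarrow> 'm \<Rightarrow> 'm \<Rightarrow> 'm \<Rightarrow> bool" where
  "candidate_triangle C f g h \<longleftrightarrow> f \<in> Ar C \<and> g \<in> Hom C (Cod C f) (Dom C h) \<and>
     h \<in> Hom C (Cod C g) (Sh C (Dom C f))"

definition triangle_map ::
  "('o, 'm, 'z) tricategory_scheme \<Rightarrow> 'm \<times> 'm \<times> 'm \<Rightarrow> 'm \<times> 'm \<times> 'm \<Rightarrow> 'm \<times> 'm \<times> 'm \<Rightarrow> bool" where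
  "triangle_map C = (\<lambda>(f, g, h) (f', g', h') (a, b, c).
     a \<in> Hom C (Dom C f) (Dom C f') \<and> b \<in> Hom C (Dom C g) (Dom C g') \<and>
     c \<in> Hom C (Dom C h) (Dom C h') \<and>
     b \<cdot>\<^bsub>C\<^esub> f = f' \<cdot>\<^bsub>C\<^esub> a \<and> c \<cdot>\<^bsub>C\<^esub> g = g' \<cdot>\<^bsub>C\<^esub> b \<and> ShA C a \<cdot>\<^bsub>C\<^esub> h = h' \<cdot>\<^bsub>C\<^esub> c)"

locale triangulated_category = additive_category C
  for C :: "('o, 'm, 'z) tricategory_scheme" (structure) +
  assumes Sh_bij: "bij_betw (Sh C) (Ob C) (Ob C)"
    and ShA_bij: "A \<in> Ob C \<Longrightarrow> B \<in> Ob C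
      \<Longrightarrow> bij_betw (ShA C) (Hom C A B) (Hom C (Sh C A) (Sh C B))"
    and ShA_Id: "A \<in> Ob C \<Longrightarrow> ShA C (Id C A) = Id C (Sh C A)"
    and ShA_Comp: "f \<in> Hom C A B \<Longrightarrow> g \<in> Hom C B D \<Longrightarrow> ShA C (g \<cdot> f) = ShA C g \<cdot> ShA C f"
    and ShA_Add: "f \<in> Hom C A B \<Longrightarrow> f' \<in> Hom C A B
      \<Longrightarrow> ShA C (Add C f f') = Add C (ShA C f) (ShA C f')"
    and Tri_candidate: "(f, g, h) \<in> Tri C \<Longrightarrow> candidate_triangle C f g h"
    and TR1_iso: "(f, g, h) \<in> Tri C \<Longrightarrow> candidate_triangle C f' g' h'
      \<Longrightarrow> triangle_map C (f, g, h) (f', g', h') (a, b, c)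
      \<Longrightarrow> iso_arrow C a \<Longrightarrow> iso_arrow C b \<Longrightarrow> iso_arrow C c \<Longrightarrow> (f', g', h') \<in> Tri C"
    and TR1_Id: "A \<in> Ob C \<Longrightarrow> is_zero C Z \<Longrightarrow> (Id C A, Zero C A Z, Zero C Z (Sh C A)) \<in> Tri C"
    and TR1_ex: "f \<in> Ar C \<Longrightarrow> \<exists>g h. (f, g, h) \<in> Tri C"
    and TR2: "candidate_triangle C f g h
      \<Longrightarrow> (f, g, h) \<in> Tri C \<longleftrightarrow> (g, h, Neg C (ShA C f)) \<in> Tri C"
    and TR3: "(f, g, h) \<in> Tri C \<Longrightarrow> (f', g', h') \<in> Tri C
      \<Longrightarrow> a \<in> Hom C (Dom C f) (Dom C f') \<Longrightarrow> b \<in> Hom C (Cod C f) (Cod C f')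
      \<Longrightarrow> b \<cdot> f = f' \<cdot> a \<Longrightarrow> \<exists>c. triangle_map C (f, g, h) (f', g', h') (a, b, c)"
    and TR4: "f \<in> Hom C A B \<Longrightarrow> g \<in> Hom C B D
      \<Longrightarrow> (f, p, p') \<in> Tri C \<Longrightarrow> (g, q, q') \<in> Tri C \<Longrightarrow> (g \<cdot> f, r, r') \<in> Tri C
      \<Longrightarrow> \<exists>u \<in> Hom C (Cod C p) (Cod C r). \<exists>v \<in> Hom C (Cod C r) (Cod C q).
            (u, v, ShA C p \<cdot> q') \<in> Tri C \<and> u \<cdot> p = r \<cdot> g \<and> r' \<cdot> u = p' \<and>
            v \<cdot> r = q \<and> q' \<cdot> v = ShA C f \<cdot> r'"

definition is_cocone :: "('o, 'm, 'z) tricategory_scheme \<Rightarrow> 'm \<Rightarrow> 'o \<Rightarrow> bool" where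
  "is_cocone C \<alpha> K \<longleftrightarrow> (\<exists>f h. (f, \<alpha>, h) \<in> Tri C \<and> Dom C f = K)"

definition full_subcategory ::
  "('o, 'm, 'z) tricategory_scheme \<Rightarrow> 'o set \<Rightarrow> ('o, 'm, 'z) tricategory_scheme" where
  "full_subcategory C \<S> =
     (let \<A> = {f \<in> Ar C. Dom C f \<in> \<S> \<and> Cod C f \<in> \<S>} in
      C\<lparr>Ob := Ob C \<inter> \<S>, Ar := \<A>, Tri := Tri C \<inter> (\<A> \<times> \<A> \<times> \<A>)\<rparr>)"

definition triangulated_subcategory :: "('o, 'm, 'z) tricategory_scheme \<Rightarrow> 'o set \<Rightarrow> bool" where
  "triangulated_subcategory C \<S> \<longleftrightarrow> \<S> \<subseteq> Ob C \<and> (\<forall>Z. is_zero C Z \<longrightarrow> Z \<in> \<S>) \<and>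
     (\<forall>A\<in>\<S>. \<forall>B\<in>Ob C. isomorphic C A B \<longrightarrow> B \<in> \<S>) \<and>
     (\<forall>A\<in>Ob C. A \<in> \<S> \<longleftrightarrow> Sh C A \<in> \<S>) \<and>
     (\<forall>(f, g, h) \<in> Tri C. Dom C f \<in> \<S> \<and> Cod C f \<in> \<S> \<longrightarrow> Cod C g \<in> \<S>)"

definition Loc :: "'u rel \<Rightarrow> ('o, 'm, 'z) tricategory_scheme \<Rightarrow> 'o \<Rightarrow> 'o set" where
  "Loc \<kappa> C M = \<Inter>{\<S>. triangulated_subcategory C \<S> \<and> M \<in> \<S> \<and> closed_under_coproducts \<kappa> C \<S>}"

text \<open>
  Well generated categories in Krause's formulation: a small set of generators that is perfect and
  consists of \<open>\<alpha>\<close>-small objects, for a regular cardinal \<open>\<alpha>\<close>.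
\<close>

definition alpha_small ::
  "'u rel \<Rightarrow> 'u rel \<Rightarrow> ('o, 'm, 'z) category_scheme \<Rightarrow> 'o \<Rightarrow> bool" where
  "alpha_small \<kappa> \<alpha> C M \<longleftrightarrow> (\<forall>(I :: 'u set) A S \<iota>. \<forall>f \<in> Hom C M S.
     small \<kappa> I \<and> (\<forall>i\<in>I. A i \<in> Ob C) \<and> is_coproduct C I A S \<iota> \<longrightarrow>
     (\<exists>J \<subseteq> I. |J| <o \<alpha> \<and> (\<exists>S' \<iota>'. is_coproduct C J A S' \<iota>' \<and>
        (\<exists>g \<in> Hom C M S'. \<exists>e \<in> Hom C S' S. (\<forall>j\<in>J. e \<cdot>\<^bsub>C\<^esub> \<iota>' j = \<iota> j) \<and> f = e \<cdot>\<^bsub>C\<^esub> g))))"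

definition hom_surj :: "('o, 'm, 'z) category_scheme \<Rightarrow> 'o \<Rightarrow> 'm \<Rightarrow> bool" where
  "hom_surj C M f \<longleftrightarrow> (\<forall>b \<in> Hom C M (Cod C f). \<exists>a \<in> Hom C M (Dom C f). f \<cdot>\<^bsub>C\<^esub> a = b)"

definition perfect_class :: "'u rel \<Rightarrow> ('o, 'm, 'z) category_scheme \<Rightarrow> 'o set \<Rightarrow> bool" where
  "perfect_class \<kappa> C \<G> \<longleftrightarrow> (\<forall>(I :: 'u set) A B f S \<iota> T \<tau> h.
     small \<kappa> I \<and> (\<forall>i\<in>I. f i \<in> Hom C (A i) (B i)) \<and>
     is_coproduct C I A S \<iota> \<and> is_coproduct C I B T \<tau> \<and>
     h \<in> Hom C S T \<and> (\<forall>i\<in>I. h \<cdot>\<^bsub>C\<^esub> \<iota> i = \<tau> i \<cdot>\<^bsub>C\<^esub> f i) \<and>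
     (\<forall>i\<in>I. \<forall>G\<in>\<G>. hom_surj C G (f i)) \<longrightarrow> (\<forall>G\<in>\<G>. hom_surj C G h))"

definition well_generated :: "'u rel \<Rightarrow> ('o, 'm, 'z) tricategory_scheme \<Rightarrow> bool" where
  "well_generated \<kappa> C \<longleftrightarrow> triangulated_category C \<and> locally_small \<kappa> C \<and> has_small_coproducts \<kappa> C \<and>
     (\<exists>\<G> \<subseteq> Ob C. small \<kappa> \<G> \<and>
        (\<forall>A\<in>Ob C. (\<forall>G\<in>\<G>. hom_vanishes C G A) \<longrightarrow> is_zero C A) \<and>
        perfect_class \<kappa> C \<G> \<and>
        (\<exists>\<alpha> :: 'u rel. Cinfinite \<alpha> \<and> regularCard \<alpha> \<and> \<alpha> <o \<kappa> \<and> (\<forall>G\<in>\<G>. alpha_small \<kappa> \<alpha> C G)))"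


section \<open>Torsion pairs and silting objects\<close>

definition perp :: "('o, 'm, 'z) tricategory_scheme \<Rightarrow> int set \<Rightarrow> 'o \<Rightarrow> 'o set" where
  "perp C I A = {B \<in> Ob C. \<forall>k\<in>I. hom_vanishes C A (shift C k B)}"

definition torsion_pair :: "('o, 'm, 'z) tricategory_scheme \<Rightarrow> 'o set \<Rightarrow> 'o set \<Rightarrow> bool" where
  "torsion_pair C \<U> \<V> \<longleftrightarrow> \<U> \<subseteq> Ob C \<and> \<V> \<subseteq> Ob C \<and>
     closed_under_summands C \<U> \<and> closed_under_summands C \<V> \<and>
     (\<forall>U\<in>\<U>. \<forall>V\<in>\<V>. hom_vanishes C U V) \<and>
     (\<forall>A\<in>Ob C. \<exists>(f, g, h) \<in> Tri C. Dom C f \<in> \<U> \<and> Cod C f = A \<and> Cod C g \<in> \<V>)"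

definition t_structure :: "('o, 'm, 'z) tricategory_scheme \<Rightarrow> 'o set \<Rightarrow> 'o set \<Rightarrow> bool" where
  "t_structure C \<U> \<V> \<longleftrightarrow> torsion_pair C \<U> \<V> \<and>
     (\<forall>U\<in>\<U>. \<forall>k>0. shift C k U \<in> \<U>) \<and>
     (\<forall>(f, g, h) \<in> Tri C. Dom C f \<in> \<U> \<and> Cod C g \<in> \<U> \<longrightarrow> Cod C f \<in> \<U>)"

definition silting :: "('o, 'm, 'z) tricategory_scheme \<Rightarrow> 'o \<Rightarrow> bool" where
  "silting C M \<longleftrightarrow> M \<in> Ob C \<and> t_structure C (perp C {0<..} M) (perp C {..0} M)"

definition partial_silting :: "'u rel \<Rightarrow> ('o, 'm, 'z) tricategory_scheme \<Rightarrow> 'o \<Rightarrow> bool" where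
  "partial_silting \<kappa> C M \<longleftrightarrow> M \<in> perp C {0<..} M \<and> closed_under_coproducts \<kappa> C (perp C {0<..} M)"


section \<open>Functors, adjunctions and recollements\<close>

record ('o1, 'm1, 'o2, 'm2) functr =
  FOb :: "'o1 \<Rightarrow> 'o2"
  FAr :: "'m1 \<Rightarrow> 'm2"

definition inclusion_functor :: "('o, 'm, 'o, 'm) functr" where
  "inclusion_functor = \<lparr>FOb = (\<lambda>A. A), FAr = (\<lambda>f. f)\<rparr>"

definition is_functor ::
  "('o1, 'm1, 'z1) category_scheme \<Rightarrow> ('o2, 'm2, 'z2) category_scheme
    \<Rightarrow> ('o1, 'm1, 'o2, 'm2) functr \<Rightarrow> bool" where
  "is_functor C D F \<longleftrightarrow>
     (\<forall>A\<in>Ob C. FOb F A \<in> Ob D \<and> FAr F (Id C A) = Id D (FOb F A)) \<and>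
     (\<forall>A B. \<forall>f \<in> Hom C A B. FAr F f \<in> Hom D (FOb F A) (FOb F B)) \<and>
     (\<forall>A B E. \<forall>f \<in> Hom C A B. \<forall>g \<in> Hom C B E. FAr F (g \<cdot>\<^bsub>C\<^esub> f) = FAr F g \<cdot>\<^bsub>D\<^esub> FAr F f)"

definition fully_faithful ::
  "('o1, 'm1, 'z1) category_scheme \<Rightarrow> ('o2, 'm2, 'z2) category_scheme
    \<Rightarrow> ('o1, 'm1, 'o2, 'm2) functr \<Rightarrow> bool" where
  "fully_faithful C D F \<longleftrightarrow>
     (\<forall>A\<in>Ob C. \<forall>B\<in>Ob C. bij_betw (FAr F) (Hom C A B) (Hom D (FOb F A) (FOb F B)))"

definition triangle_functor ::
  "('o1, 'm1, 'z1) tricategory_scheme \<Rightarrow> ('o2, 'm2, 'z2) tricategory_scheme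
    \<Rightarrow> ('o1, 'm1, 'o2, 'm2) functr \<Rightarrow> bool" where
  "triangle_functor C D F \<longleftrightarrow> is_functor C D F \<and>
     (\<forall>A B. \<forall>f \<in> Hom C A B. \<forall>g \<in> Hom C A B. FAr F (Add C f g) = Add D (FAr F f) (FAr F g)) \<and>
     (\<exists>\<phi>. (\<forall>A\<in>Ob C. \<phi> A \<in> Hom D (FOb F (Sh C A)) (Sh D (FOb F A)) \<and> iso_arrow D (\<phi> A)) \<and>
          (\<forall>A B. \<forall>f \<in> Hom C A B. \<phi> B \<cdot>\<^bsub>D\<^esub> FAr F (ShA C f) = ShA D (FAr F f) \<cdot>\<^bsub>D\<^esub> \<phi> A) \<and>
          (\<forall>(f, g, h) \<in> Tri C. (FAr F f, FAr F g, \<phi> (Dom C f) \<cdot>\<^bsub>D\<^esub> FAr F h) \<in> Tri D))"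

definition adjunction ::
  "('o1, 'm1, 'z1) category_scheme \<Rightarrow> ('o2, 'm2, 'z2) category_scheme
    \<Rightarrow> ('o1, 'm1, 'o2, 'm2) functr \<Rightarrow> ('o2, 'm2, 'o1, 'm1) functr
    \<Rightarrow> ('o1 \<Rightarrow> 'm1) \<Rightarrow> ('o2 \<Rightarrow> 'm2) \<Rightarrow> bool" where
  "adjunction C D F G \<eta> \<epsilon> \<longleftrightarrow> is_functor C D F \<and> is_functor D C G \<and>
     (\<forall>A\<in>Ob C. \<eta> A \<in> Hom C A (FOb G (FOb F A))) \<and>
     (\<forall>B\<in>Ob D. \<epsilon> B \<in> Hom D (FOb F (FOb G B)) B) \<and>
     (\<forall>A A'. \<forall>f \<in> Hom C A A'. FAr G (FAr F f) \<cdot>\<^bsub>C\<^esub> \<eta> A = \<eta> A' \<cdot>\<^bsub>C\<^esub> f) \<and>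
     (\<forall>B B'. \<forall>g \<in> Hom D B B'. g \<cdot>\<^bsub>D\<^esub> \<epsilon> B = \<epsilon> B' \<cdot>\<^bsub>D\<^esub> FAr F (FAr G g)) \<and>
     (\<forall>A\<in>Ob C. \<epsilon> (FOb F A) \<cdot>\<^bsub>D\<^esub> FAr F (\<eta> A) = Id D (FOb F A)) \<and>
     (\<forall>B\<in>Ob D. FAr G (\<epsilon> B) \<cdot>\<^bsub>C\<^esub> \<eta> (FOb G B) = Id C (FOb G B))"

text \<open>
  \<open>recollement Y D X i\<^sup>* i\<^sub>* i\<^sup>! j\<^sub>! j\<^sup>* j\<^sub>*\<close> in the sense of Beilinson, Bernstein and Deligne. Its last
  conjunct consists of the two canonical triangles \<open>i\<^sub>*i\<^sup>!Z \<rightarrow> Z \<rightarrow> j\<^sub>*j\<^sup>*Z \<rightarrow>\<close> and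
  \<open>j\<^sub>!j\<^sup>*Z \<rightarrow> Z \<rightarrow> i\<^sub>*i\<^sup>*Z \<rightarrow>\<close> formed with the (co)units of the adjunctions.
\<close>

definition recollement ::
  "('o1, 'm1, 'z1) tricategory_scheme \<Rightarrow> ('o2, 'm2, 'z2) tricategory_scheme
    \<Rightarrow> ('o3, 'm3, 'z3) tricategory_scheme
    \<Rightarrow> ('o2, 'm2, 'o1, 'm1) functr \<Rightarrow> ('o1, 'm1, 'o2, 'm2) functr \<Rightarrow> ('o2, 'm2, 'o1, 'm1) functr
    \<Rightarrow> ('o3, 'm3, 'o2, 'm2) functr \<Rightarrow> ('o2, 'm2, 'o3, 'm3) functr \<Rightarrow> ('o3, 'm3, 'o2, 'm2) functr
    \<Rightarrow> bool" where
  "recollement Y D X iU iL iS jS jU jL \<longleftrightarrow>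
     triangulated_category Y \<and> triangulated_category D \<and> triangulated_category X \<and>
     triangle_functor D Y iU \<and> triangle_functor Y D iL \<and> triangle_functor D Y iS \<and>
     triangle_functor X D jS \<and> triangle_functor D X jU \<and> triangle_functor X D jL \<and>
     fully_faithful Y D iL \<and> fully_faithful X D jS \<and> fully_faithful X D jL \<and>
     (\<forall>A\<in>Ob X. is_zero Y (FOb iS (FOb jL A))) \<and>
     (\<exists>\<eta>\<^sub>1 \<epsilon>\<^sub>1 \<eta>\<^sub>2 \<epsilon>\<^sub>2 \<eta>\<^sub>3 \<epsilon>\<^sub>3 \<eta>\<^sub>4 \<epsilon>\<^sub>4.
        adjunction D Y iU iL \<eta>\<^sub>1 \<epsilon>\<^sub>1 \<and> adjunction Y D iL iS \<eta>\<^sub>2 \<epsilon>\<^sub>2 \<and>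
        adjunction X D jS jU \<eta>\<^sub>3 \<epsilon>\<^sub>3 \<and> adjunction D X jU jL \<eta>\<^sub>4 \<epsilon>\<^sub>4 \<and>
        (\<forall>Z\<in>Ob D. (\<exists>h. (\<epsilon>\<^sub>2 Z, \<eta>\<^sub>4 Z, h) \<in> Tri D) \<and> (\<exists>h. (\<epsilon>\<^sub>3 Z, \<eta>\<^sub>1 Z, h) \<in> Tri D)))"

end

theory Submission
  imports Defs
begin

text \<open>
  Write \<open>T = j\<^sub>*\<omega>\<close>, identify \<open>\<sigma>\<close> with \<open>i\<^sub>*\<sigma>\<close>, and let \<open>N = \<sigma>\<^sup>I[1]\<close>, so that \<open>\<sigma>' \<rightarrow> T \<rightarrow> N\<close> is a triangle with second
  arrow \<open>\<alpha>\<close>. By adjunction, the conditions on \<open>i\<^sup>!Z\<close> and \<open>j\<^sup>#Z\<close> say that \<open>Z\<close> is orthogonal to \<open>\<sigma>\<close> and to \<open>T\<close> in the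
  degrees in question, and the condition on \<open>j\<^sup>*Z\<close> says that \<open>Hom(T, j\<^sub>*j\<^sup>*Z[k]) = 0\<close> for \<open>k > 0\<close>
  (\<open>perp_adjoint\<close>, \<open>perp_fully_faithful\<close>). On the other side, orthogonality to \<open>\<rho>\<close> is orthogonality to \<open>\<sigma>\<close> and to \<open>\<sigma>'\<close>.
  It remains to compare \<open>\<sigma>'\<close> with \<open>T\<close> for objects \<open>Z\<close> orthogonal to \<open>\<sigma>\<close>.

  For the coaisles this is the long exact sequence of the triangle: if \<open>Hom(\<sigma>, Z[k]) = 0\<close> for all \<open>k \<le> 0\<close>, then
  \<open>Hom(T, Z[k])\<close> and \<open>Hom(\<sigma>', Z[k])\<close> agree for \<open>k \<le> 0\<close>.

  For the aisles the essential point concerns the objects \<open>B\<close> of \<open>Y\<close> with \<open>Hom(\<sigma>, B[k]) = 0\<close> for all \<open>k > 0\<close>: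
  then \<open>Hom(T, B[k]) = 0\<close> for \<open>k \<ge> 2\<close> (\<open>T_vanishes\<close>) and every map \<open>T \<rightarrow> B[1]\<close> factors through \<open>\<alpha>\<close> (\<open>T_factors\<close>).
  To see this, approximate an object \<open>E\<close> of the aisle shifted by \<open>p\<close> by the universal map from a coproduct of
  copies of \<open>\<sigma>[p]\<close>; its cone lies in the aisle shifted by \<open>p + 1\<close> (\<open>approximation\<close>). For \<open>p \<ge> 2\<close> compactness of \<open>T\<close> makes
  the coproduct invisible to \<open>T\<close>, so \<open>Hom(T, -)\<close> is injective along the sequence of iterated cones. The homotopy
  colimit of that sequence is orthogonal to every shift of \<open>\<sigma>\<close>, hence zero, and by compactness again every map
  from \<open>T\<close> becomes zero at a finite stage. So it was zero to begin with. For \<open>p = 1\<close> the cone is invisible to \<open>T\<close> by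
  the case just treated, and a map from \<open>T\<close> to a coproduct of copies of \<open>\<sigma>[1]\<close> is a finite sum of maps through one
  summand, each of which factors through the preenvelope \<open>\<alpha>\<close>.

  Now take \<open>Z\<close> with \<open>Hom(\<sigma>, Z[k]) = 0\<close> for \<open>k > 0\<close>, and apply this to \<open>B = i\<^sup>!Z\<close> in the triangle
  \<open>B \<rightarrow> Z \<rightarrow> W\<close> with \<open>W = j\<^sub>*j\<^sup>*Z\<close>. If \<open>Hom(T, W[k]) = 0\<close>, a map \<open>\<sigma>' \<rightarrow> Z[k]\<close> extends to \<open>T\<close>, this extension
  factors through \<open>B[k]\<close>, and so it is zero or factors through \<open>\<alpha>\<close>; in both cases its restriction to \<open>\<sigma>'\<close> is
  zero. Conversely, a map \<open>T \<rightarrow> W[k]\<close> lifts to \<open>Z[k]\<close> because \<open>Hom(T, B[k+1]) = 0\<close>; if \<open>Hom(\<sigma>', Z[k]) = 0\<close>, the lift factors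
  through \<open>N\<close>, and \<open>Hom(N, W[k]) = 0\<close> because \<open>i\<^sup>!j\<^sub>* = 0\<close>.
\<close>

section \<open>Isomorphisms and coproducts\<close>

context category
begin

lemma HomD:
  assumes "f \<in> Hom C A B"
  shows "f \<in> Ar C" "Dom C f = A" "Cod C f = B" "A \<in> Ob C" "B \<in> Ob C"
  using assms Dom_in_Ob Cod_in_Ob by (auto simp: Hom_def)

lemma isomorphicE:
  assumes "isomorphic C A B"
  obtains f g where "f \<in> Hom C A B" "g \<in> Hom C B A" "g \<cdot> f = Id C A" "f \<cdot> g = Id C B"
  using assms by (auto simp: isomorphic_def iso_arrow_def Hom_def)

lemma isomorphicI:
  assumes "f \<in> Hom C A B" "g \<in> Hom C B A" "g \<cdot> f = Id C A" "f \<cdot> g = Id C B"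
  shows "isomorphic C A B"
  using assms by (auto simp: isomorphic_def iso_arrow_def Hom_def)

lemma isomorphic_refl: "A \<in> Ob C \<Longrightarrow> isomorphic C A A"
  by (rule isomorphicI[OF Id_in_Hom Id_in_Hom]) (auto intro: Id_left Id_in_Hom)

lemma isomorphic_sym: "isomorphic C A B \<Longrightarrow> isomorphic C B A"
  by (erule isomorphicE) (rule isomorphicI)

lemma isomorphic_trans:
  assumes "isomorphic C A B" "isomorphic C B D"
  shows "isomorphic C A D"
proof -
  obtain f g where f: "f \<in> Hom C A B" "g \<in> Hom C B A" "g \<cdot> f = Id C A" "f \<cdot> g = Id C B"
    using assms(1) by (rule isomorphicE)
  obtain f' g' where f': "f' \<in> Hom C B D" "g' \<in> Hom C D B" "g' \<cdot> f' = Id C B" "f' \<cdot> g' = Id C D"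
    using assms(2) by (rule isomorphicE)
  show ?thesis
  proof (rule isomorphicI)
    show ff: "f' \<cdot> f \<in> Hom C A D" and gg: "g \<cdot> g' \<in> Hom C D A"
      using f f' by (blast intro: Comp_in_Hom)+
    have "g' \<cdot> (f' \<cdot> f) = f"
      using Comp_assoc[OF f(1) f'(1) f'(2)] f' Id_left[OF f(1)] by simp
    then show "g \<cdot> g' \<cdot> (f' \<cdot> f) = Id C A"
      using Comp_assoc[OF ff f'(2) f(2)] f by simp
    have "f \<cdot> (g \<cdot> g') = g'"
      using Comp_assoc[OF f'(2) f(2) f(1)] f Id_left[OF f'(2)] by simp
    then show "f' \<cdot> f \<cdot> (g \<cdot> g') = Id C D"
      using Comp_assoc[OF gg f(1) f'(1)] f' by simp
  qed
qed

lemma is_coproductD: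
  assumes "is_coproduct C I A S \<iota>"
  shows "S \<in> Ob C" "\<And>i. i \<in> I \<Longrightarrow> \<iota> i \<in> Hom C (A i) S"
  using assms by (auto simp: is_coproduct_def)

lemma coproduct_map:
  assumes "is_coproduct C I A S \<iota>" "T \<in> Ob C" "\<And>i. i \<in> I \<Longrightarrow> f i \<in> Hom C (A i) T"
  obtains h where "h \<in> Hom C S T" "\<And>i. i \<in> I \<Longrightarrow> h \<cdot> \<iota> i = f i"
  using assms unfolding is_coproduct_def by metis

lemma coproduct_ext:
  assumes S: "is_coproduct C I A S \<iota>" and h: "h \<in> Hom C S T" "h' \<in> Hom C S T"
    and eq: "\<And>i. i \<in> I \<Longrightarrow> h \<cdot> \<iota> i = h' \<cdot> \<iota> i"
  shows "h = h'"
proof -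
  have "\<exists>!k. k \<in> Hom C S T \<and> (\<forall>i\<in>I. k \<cdot> \<iota> i = h' \<cdot> \<iota> i)"
    using S HomD(5)[OF h(1)] Comp_in_Hom[OF is_coproductD(2)[OF S] h(2)]
    unfolding is_coproduct_def by (auto dest!: spec[of _ "\<lambda>i. h' \<cdot> \<iota> i"])
  then show ?thesis
    using h eq by blast
qed

end

lemma is_coproduct_cong:
  assumes "is_coproduct C I A S \<iota>" "\<And>i. i \<in> I \<Longrightarrow> A i = A' i" "\<And>i. i \<in> I \<Longrightarrow> \<iota> i = \<iota>' i"
  shows "is_coproduct C I A' S \<iota>'"
  using assms unfolding is_coproduct_def by (simp cong: ball_cong)

lemma is_coproduct_reindex:
  assumes e: "bij_betw e J I" and S: "is_coproduct C I A S \<iota>"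
  shows "is_coproduct C J (\<lambda>j. A (e j)) S (\<lambda>j. \<iota> (e j))"
proof -
  have eJ: "\<And>j. j \<in> J \<Longrightarrow> e j \<in> I" using e by (auto simp: bij_betw_def)
  have ex: "\<exists>!h. h \<in> Hom C S T \<and> (\<forall>j\<in>J. h \<cdot>\<^bsub>C\<^esub> \<iota> (e j) = f j)"
    if T: "T \<in> Ob C" and f: "\<forall>j\<in>J. f j \<in> Hom C (A (e j)) T" for T f
  proof -
    have inv: "\<And>i. i \<in> I \<Longrightarrow> inv_into J e i \<in> J" "\<And>i. i \<in> I \<Longrightarrow> e (inv_into J e i) = i"
      "\<And>j. j \<in> J \<Longrightarrow> inv_into J e (e j) = j"
      using e by (auto simp: bij_betw_def inv_into_into f_inv_into_f)
    have "\<forall>i\<in>I. f (inv_into J e i) \<in> Hom C (A i) T"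
      using f inv by metis
    then have "\<exists>!h. h \<in> Hom C S T \<and> (\<forall>i\<in>I. h \<cdot>\<^bsub>C\<^esub> \<iota> i = f (inv_into J e i))"
      using S T unfolding is_coproduct_def by (auto dest!: spec[of _ "\<lambda>i. f (inv_into J e i)"])
    moreover have "(\<forall>i\<in>I. h \<cdot>\<^bsub>C\<^esub> \<iota> i = f (inv_into J e i)) \<longleftrightarrow> (\<forall>j\<in>J. h \<cdot>\<^bsub>C\<^esub> \<iota> (e j) = f j)" for h
      using inv eJ by metis
    ultimately show ?thesis by simp
  qed
  show ?thesis
    using S eJ ex unfolding is_coproduct_def by auto
qed

text \<open>
  Coproducts, closure under them and compactness are stated for index sets inside the type
  underlying \<open>\<kappa>\<close>. By transport along a bijection they are available for every small index set.
\<close>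

lemma small_reindex:
  fixes \<kappa> :: "'u rel" and I :: "'i set"
  assumes "size_cardinal \<kappa>" "small \<kappa> I"
  obtains J :: "'u set" and e where "bij_betw e J I" "small \<kappa> J"
proof -
  have \<kappa>: "Card_order \<kappa>" and I: "|I| <o \<kappa>"
    using assms by (auto simp: size_cardinal_def small_def)
  have "|I| \<le>o |Field \<kappa>|"
    using I card_of_Field_ordIso[OF \<kappa>] ordIso_symmetric ordLess_imp_ordLeq ordLeq_ordIso_trans by blast
  then obtain g :: "'i \<Rightarrow> 'u" where g: "inj_on g I"
    unfolding card_of_ordLeq[symmetric] by blast
  then have b: "bij_betw g I (g ` I)" by (rule inj_on_imp_bij_betw)
  have "|g ` I| <o \<kappa>"
    using ordLeq_ordLess_trans[OF card_of_image I] .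
  then show ?thesis
    using that[OF bij_betw_inv_into[OF b]] by (simp add: small_def)
qed

lemma small_nat: "size_cardinal \<kappa> \<Longrightarrow> small \<kappa> (UNIV :: nat set)"
  using ordIso_ordLess_trans[OF card_of_nat, of \<kappa>] by (simp add: size_cardinal_def small_def)

lemma ex_small_coproduct:
  fixes \<kappa> :: "'u rel" and I :: "'i set"
  assumes "size_cardinal \<kappa>" "has_small_coproducts \<kappa> C" "small \<kappa> I" "\<And>i. i \<in> I \<Longrightarrow> A i \<in> Ob C"
  obtains S \<iota> where "is_coproduct C I A S \<iota>"
proof -
  obtain J :: "'u set" and e where e: "bij_betw e J I" and J: "small \<kappa> J"
    using small_reindex[OF assms(1,3)] by blast
  have "\<And>j. j \<in> J \<Longrightarrow> e j \<in> I" using e by (auto simp: bij_betw_def)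
  then obtain S \<iota> where S: "is_coproduct C J (\<lambda>j. A (e j)) S \<iota>"
    using assms(2,4) J unfolding has_small_coproducts_def
    by (auto dest!: spec[of _ J] spec[of _ "\<lambda>j. A (e j)"])
  have "is_coproduct C I A S (\<lambda>i. \<iota> (inv_into J e i))"
    using is_coproduct_reindex[OF bij_betw_inv_into[OF e] S]
    by (rule is_coproduct_cong) (use e in \<open>auto simp: bij_betw_def f_inv_into_f\<close>)
  then show ?thesis by (rule that)
qed

lemma closed_under_coproductsD:
  fixes \<kappa> :: "'u rel" and I :: "'i set"
  assumes "size_cardinal \<kappa>" "closed_under_coproducts \<kappa> C \<S>" "small \<kappa> I"
    "is_coproduct C I A S \<iota>" "\<And>i. i \<in> I \<Longrightarrow> A i \<in> \<S>"
  shows "S \<in> \<S>"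
proof -
  obtain J :: "'u set" and e where e: "bij_betw e J I" and J: "small \<kappa> J"
    using small_reindex[OF assms(1,3)] by blast
  have "\<And>j. j \<in> J \<Longrightarrow> e j \<in> I" using e by (auto simp: bij_betw_def)
  then have "\<forall>j\<in>J. A (e j) \<in> \<S>" using assms(5) by blast
  then show ?thesis
    using assms(2) J is_coproduct_reindex[OF e assms(4)] unfolding closed_under_coproducts_def
    by (auto dest!: spec[of _ J] spec[of _ "\<lambda>j. A (e j)"])
qed

section \<open>Additive categories and vanishing of Hom groups\<close>

context additive_category
begin

lemma Zero_in_Hom: "A \<in> Ob C \<Longrightarrow> B \<in> Ob C \<Longrightarrow> Zero C A B \<in> Hom C A B"
  using comm_group.axioms(2)[OF hom_comm_group, THEN group.axioms(1), THEN monoid.one_closed]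
  by (simp add: hom_group_def)

lemma Add_in_Hom:
  assumes "f \<in> Hom C A B" "g \<in> Hom C A B"
  shows "Add C f g \<in> Hom C A B"
proof -
  interpret G: comm_group "hom_group C A B" by (rule hom_comm_group) (use HomD[OF assms(1)] in simp_all)
  show ?thesis using assms G.m_closed[of f g] by (simp add: hom_group_def)
qed

lemma Neg_in_Hom:
  assumes "f \<in> Hom C A B"
  shows "Neg C f \<in> Hom C A B"
proof -
  interpret G: comm_group "hom_group C A B" by (rule hom_comm_group) (use HomD[OF assms(1)] in simp_all)
  show ?thesis using assms G.inv_closed[of f] HomD[OF assms] by (simp add: hom_group_def Neg_def)
qed

lemma Add_Neg:
  assumes "f \<in> Hom C A B"
  shows "Add C f (Neg C f) = Zero C A B"
proof -
  interpret G: comm_group "hom_group C A B" by (rule hom_comm_group) (use HomD[OF assms(1)] in simp_all)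
  show ?thesis using assms G.r_inv[of f] HomD[OF assms] by (simp add: hom_group_def Neg_def)
qed

lemma Add_commute:
  assumes "f \<in> Hom C A B" "g \<in> Hom C A B"
  shows "Add C f g = Add C g f"
proof -
  interpret G: comm_group "hom_group C A B" by (rule hom_comm_group) (use HomD[OF assms(1)] in simp_all)
  show ?thesis using assms G.m_comm[of f g] by (simp add: hom_group_def)
qed

lemma Add_assoc:
  assumes "f \<in> Hom C A B" "g \<in> Hom C A B" "h \<in> Hom C A B"
  shows "Add C (Add C f g) h = Add C f (Add C g h)"
proof -
  interpret G: comm_group "hom_group C A B" by (rule hom_comm_group) (use HomD[OF assms(1)] in simp_all)
  show ?thesis using assms G.m_assoc[of f g h] by (simp add: hom_group_def)
qed

lemma Add_Zero:
  assumes "f \<in> Hom C A B"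
  shows "Add C f (Zero C A B) = f" "Add C (Zero C A B) f = f"
proof -
  interpret G: comm_group "hom_group C A B" by (rule hom_comm_group) (use HomD[OF assms(1)] in simp_all)
  show "Add C f (Zero C A B) = f" "Add C (Zero C A B) f = f"
    using assms G.r_one[of f] G.l_one[of f] by (simp_all add: hom_group_def)
qed

lemma Add_right_cancel:
  assumes "f \<in> Hom C A B" "g \<in> Hom C A B" "h \<in> Hom C A B" "Add C f h = Add C g h"
  shows "f = g"
proof -
  interpret G: comm_group "hom_group C A B" by (rule hom_comm_group) (use HomD[OF assms(1)] in simp_all)
  show ?thesis using assms G.right_cancel[of h f g] by (simp add: hom_group_def)
qed

lemma Neg_unique:
  assumes "f \<in> Hom C A B" "g \<in> Hom C A B" "Add C f g = Zero C A B"
  shows "g = Neg C f"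
proof (rule Add_right_cancel[OF assms(2) Neg_in_Hom[OF assms(1)] assms(1)])
  show "Add C g f = Add C (Neg C f) f"
    using assms Add_commute[OF assms(2,1)] Add_commute[OF Neg_in_Hom[OF assms(1)] assms(1)]
      Add_Neg[OF assms(1)] by simp
qed

lemma Neg_Neg: "f \<in> Hom C A B \<Longrightarrow> Neg C (Neg C f) = f"
  using Neg_unique[OF Neg_in_Hom, of f A B f] Add_Neg[of f A B] Add_commute[of f A B "Neg C f"] Neg_in_Hom[of f A B]
  by simp

lemma diff_eq_Zero:
  assumes "f \<in> Hom C A B" "g \<in> Hom C A B" "Add C f (Neg C g) = Zero C A B"
  shows "f = g"
  using Neg_unique[OF assms(1) Neg_in_Hom[OF assms(2)] assms(3)] Neg_Neg[OF assms(1)]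
    Neg_Neg[OF assms(2)] by simp

lemma Neg_Zero: "A \<in> Ob C \<Longrightarrow> B \<in> Ob C \<Longrightarrow> Neg C (Zero C A B) = Zero C A B"
  using Neg_unique[OF Zero_in_Hom Zero_in_Hom, of A B] Add_Zero(1)[OF Zero_in_Hom, of A B] by simp

lemma Comp_Zero_right:
  assumes "g \<in> Hom C B D" "A \<in> Ob C"
  shows "g \<cdot> Zero C A B = Zero C A D"
proof -
  have z: "Zero C A B \<in> Hom C A B" using assms HomD[OF assms(1)] by (simp add: Zero_in_Hom)
  have gz: "g \<cdot> Zero C A B \<in> Hom C A D" using z assms(1) by (rule Comp_in_Hom)
  have z': "Zero C A D \<in> Hom C A D" using assms HomD[OF assms(1)] by (simp add: Zero_in_Hom)
  show ?thesis
    using Add_right_cancel[OF gz z' gz] Comp_Add_right[OF z z assms(1)] Add_Zero(2)[OF gz]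
      Add_Zero(1)[OF z] by simp
qed

lemma Comp_Zero_left:
  assumes "f \<in> Hom C A B" "D \<in> Ob C"
  shows "Zero C B D \<cdot> f = Zero C A D"
proof -
  have z: "Zero C B D \<in> Hom C B D" using assms HomD[OF assms(1)] by (simp add: Zero_in_Hom)
  have gz: "Zero C B D \<cdot> f \<in> Hom C A D" using assms(1) z by (rule Comp_in_Hom)
  have z': "Zero C A D \<in> Hom C A D" using assms HomD[OF assms(1)] by (simp add: Zero_in_Hom)
  show ?thesis
    using Add_right_cancel[OF gz z' gz] Comp_Add_left[OF assms(1) z z] Add_Zero(2)[OF gz]
      Add_Zero(1)[OF z] by simp
qed

lemma Comp_Neg_right:
  assumes "f \<in> Hom C A B" "g \<in> Hom C B D"
  shows "g \<cdot> Neg C f = Neg C (g \<cdot> f)"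
proof (rule Neg_unique)
  show "g \<cdot> f \<in> Hom C A D" "g \<cdot> Neg C f \<in> Hom C A D"
    using assms by (blast intro: Comp_in_Hom Neg_in_Hom)+
  show "Add C (g \<cdot> f) (g \<cdot> Neg C f) = Zero C A D"
    using Comp_Add_right[OF assms(1) Neg_in_Hom[OF assms(1)] assms(2)] Add_Neg[OF assms(1)]
      Comp_Zero_right[OF assms(2)] HomD[OF assms(1)] by simp
qed

lemma Comp_Neg_left:
  assumes "f \<in> Hom C A B" "g \<in> Hom C B D"
  shows "Neg C g \<cdot> f = Neg C (g \<cdot> f)"
proof (rule Neg_unique)
  show "g \<cdot> f \<in> Hom C A D" "Neg C g \<cdot> f \<in> Hom C A D"
    using assms by (blast intro: Comp_in_Hom Neg_in_Hom)+
  show "Add C (g \<cdot> f) (Neg C g \<cdot> f) = Zero C A D"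
    using Comp_Add_left[OF assms(1,2) Neg_in_Hom[OF assms(2)]] Add_Neg[OF assms(2)]
      Comp_Zero_left[OF assms(1)] HomD[OF assms(2)] by simp
qed

lemma hom_vanishesI:
  assumes "A \<in> Ob C" "B \<in> Ob C" "\<And>f. f \<in> Hom C A B \<Longrightarrow> f = Zero C A B"
  shows "hom_vanishes C A B"
  using assms Zero_in_Hom[of A B] unfolding hom_vanishes_def by blast

lemma hom_vanishesD: "hom_vanishes C A B \<Longrightarrow> f \<in> Hom C A B \<Longrightarrow> f = Zero C A B"
  by (auto simp: hom_vanishes_def)

lemma hom_vanishes_retract:
  assumes "s \<in> Hom C B B'" "r \<in> Hom C B' B" "r \<cdot> s = Id C B" "A \<in> Ob C" "hom_vanishes C A B'"
  shows "hom_vanishes C A B"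
proof (rule hom_vanishesI)
  show "A \<in> Ob C" "B \<in> Ob C" using assms(4) HomD[OF assms(1)] by simp_all
  fix f assume f: "f \<in> Hom C A B"
  have "f = r \<cdot> (s \<cdot> f)" using Comp_assoc[OF f assms(1,2)] Id_left[OF f] assms(3) by simp
  also have "s \<cdot> f = Zero C A B'" using hom_vanishesD[OF assms(5)] Comp_in_Hom[OF f assms(1)] by blast
  finally show "f = Zero C A B" using Comp_Zero_right[OF assms(2,4)] by simp
qed

lemma hom_vanishes_isomorphic:
  assumes "isomorphic C B B'" "A \<in> Ob C"
  shows "hom_vanishes C A B \<longleftrightarrow> hom_vanishes C A B'"
  using assms by (meson isomorphicE hom_vanishes_retract)

lemma hom_vanishes_coproduct:
  assumes S: "is_coproduct C I A S \<iota>" and W: "W \<in> Ob C" and v: "\<And>i. i \<in> I \<Longrightarrow> hom_vanishes C (A i) W"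
  shows "hom_vanishes C S W"
proof (rule hom_vanishesI[OF is_coproductD(1)[OF S] W])
  fix f assume f: "f \<in> Hom C S W"
  show "f = Zero C S W"
  proof (rule coproduct_ext[OF S f Zero_in_Hom[OF is_coproductD(1)[OF S] W]])
    fix i assume i: "i \<in> I"
    show "f \<cdot> \<iota> i = Zero C S W \<cdot> \<iota> i"
      using Comp_Zero_left[OF is_coproductD(2)[OF S i] W]
        hom_vanishesD[OF v[OF i] Comp_in_Hom[OF is_coproductD(2)[OF S i] f]] by simp
  qed
qed

lemma hom_vanishes_direct_sum:
  assumes S: "direct_sum C A B S" and W: "W \<in> Ob C"
  shows "hom_vanishes C S W \<longleftrightarrow> hom_vanishes C A W \<and> hom_vanishes C B W"
proof -
  obtain i1 i2 p1 p2 where i: "i1 \<in> Hom C A S" "i2 \<in> Hom C B S" and p: "p1 \<in> Hom C S A" "p2 \<in> Hom C S B"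
    and pi: "p1 \<cdot> i1 = Id C A" "p2 \<cdot> i2 = Id C B" and sum: "Add C (i1 \<cdot> p1) (i2 \<cdot> p2) = Id C S"
    using S unfolding direct_sum_def by blast
  have comp: "hom_vanishes C M W" if S: "hom_vanishes C S W"
    and j: "j \<in> Hom C M S" and q: "q \<in> Hom C S M" and qj: "q \<cdot> j = Id C M" for M j q
  proof (rule hom_vanishesI[OF _ W])
    show "M \<in> Ob C" using HomD[OF j] by simp
    fix f assume f: "f \<in> Hom C M W"
    have "f = (f \<cdot> q) \<cdot> j" using Comp_assoc[OF j q f] Id_right[OF f] qj by simp
    also have "f \<cdot> q = Zero C S W" using S Comp_in_Hom[OF q f] by (rule hom_vanishesD)
    finally show "f = Zero C M W" using Comp_Zero_left[OF j W] by simp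
  qed
  have "hom_vanishes C S W" if A: "hom_vanishes C A W" and B: "hom_vanishes C B W"
  proof (rule hom_vanishesI[OF _ W])
    show S: "S \<in> Ob C" using HomD[OF i(1)] by simp
    fix f assume f: "f \<in> Hom C S W"
    have "f = f \<cdot> Add C (i1 \<cdot> p1) (i2 \<cdot> p2)" using Id_right[OF f] sum by simp
    also have "\<dots> = Add C (f \<cdot> (i1 \<cdot> p1)) (f \<cdot> (i2 \<cdot> p2))"
      using Comp_Add_right[OF Comp_in_Hom[OF p(1) i(1)] Comp_in_Hom[OF p(2) i(2)] f] .
    also have "f \<cdot> (i1 \<cdot> p1) = Zero C S W"
      using Comp_assoc[OF p(1) i(1) f] hom_vanishesD[OF A Comp_in_Hom[OF i(1) f]]
        Comp_Zero_left[OF p(1) W] by simp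
    also have "f \<cdot> (i2 \<cdot> p2) = Zero C S W"
      using Comp_assoc[OF p(2) i(2) f] hom_vanishesD[OF B Comp_in_Hom[OF i(2) f]]
        Comp_Zero_left[OF p(2) W] by simp
    finally show "f = Zero C S W" using Add_Zero[OF Zero_in_Hom[OF S W]] by simp
  qed
  then show ?thesis using comp[OF _ i(1) p(1) pi(1)] comp[OF _ i(2) p(2) pi(2)] by blast
qed

text \<open>The objects without nonzero maps to a fixed object form a class closed under the operations
  that define \<open>add\<close>.\<close>

lemma hom_vanishes_add_closure:
  assumes N: "N \<in> add_closure C M" and v: "hom_vanishes C M W" and M: "M \<in> Ob C" and W: "W \<in> Ob C"
  shows "hom_vanishes C N W"
proof -
  let ?S = "{A \<in> Ob C. hom_vanishes C A W}"
  have "closed_under_finite_coproducts C ?S"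
    unfolding closed_under_finite_coproducts_def
    using is_coproductD(1) hom_vanishes_coproduct[OF _ W] by fast
  moreover have "closed_under_summands C ?S"
    unfolding closed_under_summands_def using hom_vanishes_direct_sum[OF _ W] by blast
  ultimately have "add_closure C M \<subseteq> ?S"
    unfolding add_closure_def using v M by (intro Inter_lower) blast
  then show ?thesis using N by blast
qed

text \<open>
  Maps from a compact object into a coproduct are finite sums of maps into the summands. Phrased as an
  induction principle: a property that is closed under addition and holds for \<open>0\<close> and for all maps
  through one summand holds for all maps into the coproduct.
\<close>

lemma compact_induct:
  fixes \<kappa> :: "'u rel" and I :: "'i set"
  assumes \<kappa>: "size_cardinal \<kappa>" and M: "compact_object \<kappa> C M" and I: "small \<kappa> I"
    and A: "\<And>i. i \<in> I \<Longrightarrow> A i \<in> Ob C" and S: "is_coproduct C I A S \<iota>" and f: "f \<in> Hom C M S"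
    and zero: "P (Zero C M S)"
    and add: "\<And>x y. x \<in> Hom C M S \<Longrightarrow> y \<in> Hom C M S \<Longrightarrow> P x \<Longrightarrow> P y \<Longrightarrow> P (Add C x y)"
    and gen: "\<And>i a. i \<in> I \<Longrightarrow> a \<in> Hom C M (A i) \<Longrightarrow> P (\<iota> i \<cdot> a)"
  shows "P f"
proof -
  obtain J :: "'u set" and e where e: "bij_betw e J I" and J: "small \<kappa> J"
    using small_reindex[OF \<kappa> I] by blast
  have eJ: "\<And>j. j \<in> J \<Longrightarrow> e j \<in> I" using e by (auto simp: bij_betw_def)
  let ?G = "hom_group C M S"
  let ?F = "\<lambda>\<phi>. finprod ?G (\<lambda>j. \<iota> (e j) \<cdot> \<phi> j) {j\<in>J. \<phi> j \<noteq> Zero C M (A (e j))}"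
  have "?F \<in> iso (sum_group J (\<lambda>j. hom_group C M (A (e j)))) ?G"
    using M J A eJ is_coproduct_reindex[OF e S]
    unfolding compact_object_def
    by (elim conjE allE[of _ J] allE[of _ "\<lambda>j. A (e j)"] allE[of _ S] allE[of _ "\<lambda>j. \<iota> (e j)"]) simp
  then have "?F ` carrier (sum_group J (\<lambda>j. hom_group C M (A (e j)))) = Hom C M S"
    by (simp add: iso_def bij_betw_def hom_group_def)
  then obtain \<phi> where \<phi>: "\<phi> \<in> carrier (sum_group J (\<lambda>j. hom_group C M (A (e j))))" and f: "f = ?F \<phi>"
    using f by (metis (no_types, lifting) imageE)
  have MOb: "M \<in> Ob C" using M by (simp add: compact_object_def)
  have grp: "group (hom_group C M (A (e j)))" if "j \<in> J" for j
    using comm_group.axioms(2)[OF hom_comm_group[OF MOb A[OF eJ[OF that]]]] .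
  have fin: "finite {j\<in>J. \<phi> j \<noteq> Zero C M (A (e j))}"
    and in_hom: "\<And>j. j \<in> J \<Longrightarrow> \<phi> j \<in> Hom C M (A (e j))"
    using \<phi> carrier_sum_group[of J "\<lambda>j. hom_group C M (A (e j))", OF grp]
    by (simp_all add: hom_group_def PiE_iff)
  interpret G: comm_group ?G
    using hom_comm_group[OF MOb is_coproductD(1)[OF S]] .
  have car: "carrier ?G = Hom C M S" "\<one>\<^bsub>?G\<^esub> = Zero C M S" "\<And>x y. x \<otimes>\<^bsub>?G\<^esub> y = Add C x y"
    by (simp_all add: hom_group_def)
  have mem: "\<And>j. j \<in> J \<Longrightarrow> \<iota> (e j) \<cdot> \<phi> j \<in> Hom C M S"
    using Comp_in_Hom[OF in_hom is_coproductD(2)[OF S eJ]] .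
  have "finite K \<Longrightarrow> K \<subseteq> J \<Longrightarrow> P (finprod ?G (\<lambda>j. \<iota> (e j) \<cdot> \<phi> j) K)" for K
  proof (induction K rule: finite_induct)
    case empty
    then show ?case using zero car by simp
  next
    case (insert k K)
    have K: "finprod ?G (\<lambda>j. \<iota> (e j) \<cdot> \<phi> j) K \<in> Hom C M S"
      using G.finprod_closed[of "\<lambda>j. \<iota> (e j) \<cdot> \<phi> j" K] insert.prems mem
      by (auto simp: car Pi_iff)
    have "finprod ?G (\<lambda>j. \<iota> (e j) \<cdot> \<phi> j) (insert k K) =
        Add C (\<iota> (e k) \<cdot> \<phi> k) (finprod ?G (\<lambda>j. \<iota> (e j) \<cdot> \<phi> j) K)"
      using G.finprod_insert[OF insert.hyps, of "\<lambda>j. \<iota> (e j) \<cdot> \<phi> j"] insert.prems mem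
      by (auto simp: car Pi_iff)
    then show ?case
      using add[OF mem K] gen eJ in_hom insert by simp
  qed
  then show ?thesis unfolding f using fin by blast
qed

end

section \<open>Exact sequences and shifts in a triangulated category\<close>

context triangulated_category
begin

lemma TriD:
  assumes "(f, g, h) \<in> Tri C"
  obtains A B D where "f \<in> Hom C A B" "g \<in> Hom C B D" "h \<in> Hom C D (Sh C A)"
    "A \<in> Ob C" "B \<in> Ob C" "D \<in> Ob C"
proof -
  have c: "f \<in> Ar C" "g \<in> Hom C (Cod C f) (Dom C h)" "h \<in> Hom C (Cod C g) (Sh C (Dom C f))"
    using Tri_candidate[OF assms] by (auto simp: candidate_triangle_def)
  have f: "f \<in> Hom C (Dom C f) (Cod C f)" using c(1) by (simp add: Hom_def)
  have "Dom C h = Cod C g" using HomD[OF c(2)] by simp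
  then show ?thesis
    using that[OF f _ c(3)] c(2) HomD[OF f] HomD[OF c(3)] by simp
qed

lemma candidate_triangleI:
  assumes "f \<in> Hom C A B" "g \<in> Hom C B D" "h \<in> Hom C D (Sh C A)"
  shows "candidate_triangle C f g h"
  using assms HomD[OF assms(1)] HomD[OF assms(2)] HomD[OF assms(3)]
  by (simp add: candidate_triangle_def)

lemma Tri_rotate: "(f, g, h) \<in> Tri C \<Longrightarrow> (g, h, Neg C (ShA C f)) \<in> Tri C"
  using TR2 Tri_candidate by blast

lemma Sh_in_Ob: "A \<in> Ob C \<Longrightarrow> Sh C A \<in> Ob C"
  using Sh_bij by (auto simp: bij_betw_def)

lemma Sh_inj: "A \<in> Ob C \<Longrightarrow> B \<in> Ob C \<Longrightarrow> Sh C A = Sh C B \<Longrightarrow> A = B"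
  using Sh_bij by (auto simp: bij_betw_def dest: inj_onD)

lemma Sh_surj:
  assumes "A \<in> Ob C"
  obtains A' where "A' \<in> Ob C" "A = Sh C A'"
  using assms Sh_bij by (auto simp: bij_betw_def)

lemma ShA_in_Hom:
  assumes "f \<in> Hom C A B"
  shows "ShA C f \<in> Hom C (Sh C A) (Sh C B)"
  using ShA_bij[of A B] HomD[OF assms] assms by (auto simp: bij_betw_def)

lemma ShA_surj:
  assumes "A \<in> Ob C" "B \<in> Ob C" "g \<in> Hom C (Sh C A) (Sh C B)"
  obtains f where "f \<in> Hom C A B" "g = ShA C f"
  using assms ShA_bij[of A B] by (auto simp: bij_betw_def)

lemma ShA_inj:
  assumes "f \<in> Hom C A B" "g \<in> Hom C A B" "ShA C f = ShA C g"
  shows "f = g"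
  using ShA_bij[of A B] HomD[OF assms(1)] assms by (auto simp: bij_betw_def dest: inj_onD)

lemma ShA_Zero:
  assumes "A \<in> Ob C" "B \<in> Ob C"
  shows "ShA C (Zero C A B) = Zero C (Sh C A) (Sh C B)"
proof -
  have z: "Zero C A B \<in> Hom C A B" using assms by (rule Zero_in_Hom)
  have z': "Zero C (Sh C A) (Sh C B) \<in> Hom C (Sh C A) (Sh C B)"
    using assms by (intro Zero_in_Hom Sh_in_Ob)
  show ?thesis
    using Add_right_cancel[OF ShA_in_Hom[OF z] z' ShA_in_Hom[OF z]] ShA_Add[OF z z] Add_Zero[OF z]
      Add_Zero(2)[OF ShA_in_Hom[OF z]] by simp
qed

lemma hom_vanishes_Sh:
  assumes "A \<in> Ob C" "B \<in> Ob C"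
  shows "hom_vanishes C (Sh C A) (Sh C B) \<longleftrightarrow> hom_vanishes C A B"
proof
  assume v: "hom_vanishes C (Sh C A) (Sh C B)"
  show "hom_vanishes C A B"
  proof (rule hom_vanishesI[OF assms])
    fix f assume f: "f \<in> Hom C A B"
    show "f = Zero C A B"
      using ShA_inj[OF f Zero_in_Hom[OF assms]] hom_vanishesD[OF v ShA_in_Hom[OF f]] ShA_Zero[OF assms]
      by simp
  qed
next
  assume v: "hom_vanishes C A B"
  show "hom_vanishes C (Sh C A) (Sh C B)"
  proof (rule hom_vanishesI[OF Sh_in_Ob[OF assms(1)] Sh_in_Ob[OF assms(2)]])
    fix g assume "g \<in> Hom C (Sh C A) (Sh C B)"
    then obtain f where f: "f \<in> Hom C A B" "g = ShA C f" using ShA_surj[OF assms] by blast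
    then show "g = Zero C (Sh C A) (Sh C B)" using hom_vanishesD[OF v] ShA_Zero[OF assms] by simp
  qed
qed

lemma Sh_zero:
  assumes Z: "is_zero C Z"
  shows "is_zero C (Sh C Z)"
  unfolding is_zero_def
proof (intro conjI ballI)
  have Z': "Z \<in> Ob C" using Z by (simp add: is_zero_def)
  then show "Sh C Z \<in> Ob C" by (rule Sh_in_Ob)
  fix B assume "B \<in> Ob C"
  then obtain B' where B': "B' \<in> Ob C" "B = Sh C B'" by (rule Sh_surj)
  show "hom_vanishes C (Sh C Z) B" "hom_vanishes C B (Sh C Z)"
    using Z B' hom_vanishes_Sh[OF Z' B'(1)] hom_vanishes_Sh[OF B'(1) Z'] by (simp_all add: is_zero_def)
qed

text \<open>Exactness of \<open>Hom(Q, -)\<close> on a triangle, at its middle term.\<close>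

lemma Tri_exact_right:
  assumes t: "(f, g, h) \<in> Tri C" and f: "f \<in> Hom C A B" and g: "g \<in> Hom C B D"
    and x: "x \<in> Hom C Q B" and gx: "g \<cdot> x = Zero C Q D"
  obtains y where "y \<in> Hom C Q A" "f \<cdot> y = x"
proof -
  have Ob: "A \<in> Ob C" "B \<in> Ob C" "D \<in> Ob C" "Q \<in> Ob C" using HomD[OF f] HomD[OF g] HomD[OF x] by simp_all
  have h: "h \<in> Hom C D (Sh C A)" by (rule TriD[OF t]) (use HomD[OF f] HomD[OF g] in \<open>simp add: Hom_def\<close>)
  obtain Z where Z: "is_zero C Z" using ex_zero by blast
  have ZOb: "Z \<in> Ob C" using Z by (simp add: is_zero_def)
  note SQ = Sh_in_Ob[OF Ob(4)]
  have IdQ: "ShA C (Id C Q) = Id C (Sh C Q)" using ShA_Id[OF Ob(4)] .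
  have "(Zero C Q Z, Zero C Z (Sh C Q), Neg C (Id C (Sh C Q))) \<in> Tri C"
    using Tri_rotate[OF TR1_Id[OF Ob(4) Z]] IdQ by simp
  moreover note Tri_rotate[OF t]
  moreover have zQ: "Zero C Q Z \<in> Hom C Q Z" and zD: "Zero C Z D \<in> Hom C Z D"
    using Ob ZOb by (auto intro: Zero_in_Hom)
  moreover have "Zero C Z D \<cdot> Zero C Q Z = g \<cdot> x"
    using Comp_Zero_left[OF zQ Ob(3)] gx by simp
  \<comment> \<open>Map the rotated triangle \<open>Q \<rightarrow> 0 \<rightarrow> Q[1]\<close> to the rotated \<open>B \<rightarrow> D \<rightarrow> A[1]\<close>.\<close>
  ultimately obtain c where c: "triangle_map C (Zero C Q Z, Zero C Z (Sh C Q), Neg C (Id C (Sh C Q)))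
      (g, h, Neg C (ShA C f)) (x, Zero C Z D, c)"
    using TR3[where a=x and b="Zero C Z D"] x HomD[OF g] HomD[OF zQ] by fastforce
  have NI: "Neg C (Id C (Sh C Q)) \<in> Hom C (Sh C Q) (Sh C Q)"
    using Id_in_Hom[OF SQ] by (rule Neg_in_Hom)
  have Nf: "Neg C (ShA C f) \<in> Hom C (Sh C A) (Sh C B)"
    using ShA_in_Hom[OF f] by (rule Neg_in_Hom)
  have c': "c \<in> Hom C (Sh C Q) (Sh C A)"
    "ShA C x \<cdot> Neg C (Id C (Sh C Q)) = Neg C (ShA C f) \<cdot> c"
    using c HomD[OF NI] HomD[OF Nf] HomD[OF h] by (auto simp: triangle_map_def)
  have e: "Neg C (ShA C x) = Neg C (ShA C f \<cdot> c)"
    using c' Comp_Neg_right[OF Id_in_Hom[OF SQ] ShA_in_Hom[OF x]] Id_right[OF ShA_in_Hom[OF x]]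
      Comp_Neg_left[OF c'(1) ShA_in_Hom[OF f]] by simp
  obtain y where y: "y \<in> Hom C Q A" "c = ShA C y" using ShA_surj[OF Ob(4,1) c'(1)] .
  have "ShA C x = ShA C f \<cdot> c"
    using arg_cong[OF e, of "Neg C"] Neg_Neg[OF ShA_in_Hom[OF x]]
      Neg_Neg[OF Comp_in_Hom[OF c'(1) ShA_in_Hom[OF f]]] by simp
  also have "\<dots> = ShA C (f \<cdot> y)" using ShA_Comp[OF y(1) f] y(2) by simp
  finally have "x = f \<cdot> y" using ShA_inj[OF x Comp_in_Hom[OF y(1) f]] by blast
  then show ?thesis using that y(1) by simp
qed

text \<open>Exactness of \<open>Hom(-, Q)\<close> on a triangle, at its middle term.\<close>

lemma Tri_exact_left:
  assumes t: "(f, g, h) \<in> Tri C" and f: "f \<in> Hom C A B" and g: "g \<in> Hom C B D"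
    and x: "x \<in> Hom C B Q" and xf: "x \<cdot> f = Zero C A Q"
  obtains y where "y \<in> Hom C D Q" "y \<cdot> g = x"
proof -
  have Ob: "A \<in> Ob C" "B \<in> Ob C" "D \<in> Ob C" "Q \<in> Ob C" using HomD[OF f] HomD[OF g] HomD[OF x] by simp_all
  have h: "h \<in> Hom C D (Sh C A)" by (rule TriD[OF t]) (use HomD[OF f] HomD[OF g] in \<open>simp add: Hom_def\<close>)
  obtain Z where Z: "is_zero C Z" using ex_zero by blast
  have ZOb: "Z \<in> Ob C" using Z by (simp add: is_zero_def)
  have zZ: "Zero C Z Q \<in> Hom C Z Q" and zQ: "Zero C Q (Sh C Z) \<in> Hom C Q (Sh C Z)"
    and zA: "Zero C A Z \<in> Hom C A Z"
    using Ob ZOb Sh_in_Ob by (auto intro: Zero_in_Hom)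
  have cand: "candidate_triangle C (Zero C Z Q) (Id C Q) (Zero C Q (Sh C Z))"
    using zZ Id_in_Hom[OF Ob(4)] zQ by (rule candidate_triangleI)
  have "Neg C (ShA C (Zero C Z Q)) = Zero C (Sh C Z) (Sh C Q)"
    using ShA_Zero[OF ZOb Ob(4)] Neg_Zero Sh_in_Ob ZOb Ob by simp
  then have "(Zero C Z Q, Id C Q, Zero C Q (Sh C Z)) \<in> Tri C"
    using TR2[OF cand] TR1_Id[OF Ob(4) Sh_zero[OF Z]] by simp
  moreover have "x \<cdot> f = Zero C Z Q \<cdot> Zero C A Z"
    using xf Comp_Zero_left[OF zA Ob(4)] by simp
  \<comment> \<open>Map the given triangle to \<open>0 \<rightarrow> Q \<rightarrow> Q\<close>.\<close>
  ultimately obtain c where "triangle_map C (f, g, h) (Zero C Z Q, Id C Q, Zero C Q (Sh C Z)) (Zero C A Z, x, c)"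
    using TR3[OF t, where a="Zero C A Z" and b=x] x zA HomD[OF f] HomD[OF zZ] by fastforce
  then have "c \<in> Hom C D Q" "c \<cdot> g = Id C Q \<cdot> x"
    using HomD[OF h] HomD[OF zQ] by (auto simp: triangle_map_def)
  then show ?thesis using that Id_left[OF x] by simp
qed

lemma Tri_comp_zero:
  assumes t: "(f, g, h) \<in> Tri C" and f: "f \<in> Hom C A B" and g: "g \<in> Hom C B D"
  shows "g \<cdot> f = Zero C A D"
proof -
  have Ob: "A \<in> Ob C" "B \<in> Ob C" "D \<in> Ob C" using HomD[OF f] HomD[OF g] by simp_all
  have h: "h \<in> Hom C D (Sh C A)" by (rule TriD[OF t]) (use HomD[OF f] HomD[OF g] in \<open>simp add: Hom_def\<close>)
  obtain Z where Z: "is_zero C Z" using ex_zero by blast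
  have ZOb: "Z \<in> Ob C" using Z by (simp add: is_zero_def)
  have zA: "Zero C A Z \<in> Hom C A Z" and zZ: "Zero C Z (Sh C A) \<in> Hom C Z (Sh C A)"
    using Ob ZOb Sh_in_Ob by (auto intro: Zero_in_Hom)
  note IdA = Id_in_Hom[OF Ob(1)]
  obtain c where "triangle_map C (Id C A, Zero C A Z, Zero C Z (Sh C A)) (f, g, h) (Id C A, f, c)"
    using TR3[OF TR1_Id[OF Ob(1) Z] t, where a="Id C A" and b=f] f IdA HomD[OF f] HomD[OF IdA] by fastforce
  then have c: "c \<in> Hom C Z D" "c \<cdot> Zero C A Z = g \<cdot> f"
    using HomD[OF h] HomD[OF zZ] by (auto simp: triangle_map_def)
  show ?thesis using c(2) Comp_Zero_right[OF c(1) Ob(1)] by simp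
qed

text \<open>
  Exactness of \<open>Hom(-, Q)\<close> at the first term of the triangle \<open>A \<rightarrow> B \<rightarrow> D \<rightarrow> A[1]\<close>: a map \<open>x\<close> out of \<open>A\<close>
  extends to \<open>B\<close> if its restriction to \<open>D[-1]\<close> vanishes. That condition is stated after one shift.
\<close>

lemma Tri_extend_first:
  assumes t: "(f, g, h) \<in> Tri C" and f: "f \<in> Hom C A B" and h: "h \<in> Hom C D (Sh C A)"
    and x: "x \<in> Hom C A Q" and xh: "ShA C x \<cdot> h = Zero C D (Sh C Q)"
  obtains y where "y \<in> Hom C B Q" "y \<cdot> f = x"
proof -
  have Nf: "Neg C (ShA C f) \<in> Hom C (Sh C A) (Sh C B)"
    using ShA_in_Hom[OF f] by (rule Neg_in_Hom)
  obtain y' where y': "y' \<in> Hom C (Sh C B) (Sh C Q)" "y' \<cdot> Neg C (ShA C f) = ShA C x"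
    using Tri_exact_left[OF Tri_rotate[OF Tri_rotate[OF t]] h Nf ShA_in_Hom[OF x] xh] .
  have Ny: "Neg C y' \<in> Hom C (Sh C B) (Sh C Q)" using y'(1) by (rule Neg_in_Hom)
  obtain y where y: "y \<in> Hom C B Q" "Neg C y' = ShA C y"
    using ShA_surj[OF _ _ Ny] HomD[OF f] HomD[OF x] by metis
  have "ShA C x = ShA C y \<cdot> ShA C f"
    using y'(2) Comp_Neg_right[OF ShA_in_Hom[OF f] y'(1)] Comp_Neg_left[OF ShA_in_Hom[OF f] y'(1)] y(2)
    by simp
  then have "x = y \<cdot> f"
    using ShA_Comp[OF f y(1)] ShA_inj[OF x Comp_in_Hom[OF f y(1)]] by simp
  then show ?thesis using that y(1) by simp
qed

lemma hom_vanishes_cone: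
  assumes t: "(f, g, h) \<in> Tri C" and g: "g \<in> Hom C B D" and h: "h \<in> Hom C D (Sh C A)"
    and Q: "Q \<in> Ob C" "hom_vanishes C Q B" "hom_vanishes C Q (Sh C A)"
  shows "hom_vanishes C Q D"
proof (rule hom_vanishesI[OF Q(1)])
  show "D \<in> Ob C" using HomD[OF g] by simp
  fix x assume x: "x \<in> Hom C Q D"
  obtain y where y: "y \<in> Hom C Q B" "g \<cdot> y = x"
    using Tri_exact_right[OF Tri_rotate[OF t] g h x hom_vanishesD[OF Q(3) Comp_in_Hom[OF x h]]] .
  then show "x = Zero C Q D"
    using hom_vanishesD[OF Q(2) y(1)] Comp_Zero_right[OF g Q(1)] by simp
qed

lemma inv_Sh:
  assumes "A \<in> Ob C"
  shows "inv_into (Ob C) (Sh C) A \<in> Ob C" "Sh C (inv_into (Ob C) (Sh C) A) = A"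
  using assms Sh_bij by (auto simp: bij_betw_def inv_into_into f_inv_into_f)

lemma shift_in_Ob:
  assumes "A \<in> Ob C"
  shows "shift C k A \<in> Ob C"
proof -
  have "(Sh C ^^ n) A \<in> Ob C" for n using assms by (induction n) (auto intro: Sh_in_Ob)
  moreover have "(inv_into (Ob C) (Sh C) ^^ n) A \<in> Ob C" for n
    using assms by (induction n) (auto intro: inv_Sh)
  ultimately show ?thesis by (simp add: shift_def)
qed

lemma shift_0 [simp]: "shift C 0 A = A"
  by (simp add: shift_def)

lemma shift_plus1:
  assumes "A \<in> Ob C"
  shows "shift C (k + 1) A = Sh C (shift C k A)"
proof (cases "k \<ge> 0")
  case True
  then have "nat (k + 1) = Suc (nat k)" by simp
  then show ?thesis using True by (simp add: shift_def)
next
  case False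
  define n where "n = nat (- k - 1)"
  have n: "nat (- k) = Suc n" "k + 1 = - int n" using False by (simp_all add: n_def)
  have "inv_into (Ob C) (Sh C) ((inv_into (Ob C) (Sh C) ^^ n) A) = shift C k A"
    using False n by (simp add: shift_def)
  moreover have "(inv_into (Ob C) (Sh C) ^^ n) A = shift C (k + 1) A"
    unfolding n(2) by (cases "n = 0") (simp_all add: shift_def)
  ultimately show ?thesis
    using inv_Sh(2)[OF shift_in_Ob[OF assms]] by metis
qed

lemma shift_minus1: "A \<in> Ob C \<Longrightarrow> Sh C (shift C (k - 1) A) = shift C k A"
  using shift_plus1[of A "k - 1"] by simp

lemma shift_add:
  assumes "A \<in> Ob C"
  shows "shift C (a + b) A = shift C a (shift C b A)"
proof (induction a rule: int_induct[where k = 0])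
  case base
  show ?case by simp
next
  case (step1 i)
  have "shift C (i + 1 + b) A = Sh C (shift C (i + b) A)"
    using shift_plus1[OF assms, of "i + b"] by (simp add: algebra_simps)
  then show ?case using step1 shift_plus1[OF shift_in_Ob[OF assms]] by simp
next
  case (step2 i)
  have e: "Sh C (shift C (i - 1 + b) A) = Sh C (shift C (i - 1) (shift C b A))"
    using shift_minus1[OF assms, of "i + b"] shift_minus1[OF shift_in_Ob[OF assms], of i] step2
    by (simp add: algebra_simps)
  show ?case using Sh_inj[OF shift_in_Ob[OF assms] shift_in_Ob[OF shift_in_Ob[OF assms]] e] .
qed

lemma shift_1: "A \<in> Ob C \<Longrightarrow> shift C 1 A = Sh C A"
  using shift_plus1[of A 0] by simp

lemma shift_Sh: "A \<in> Ob C \<Longrightarrow> shift C k (Sh C A) = shift C (k + 1) A"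
  using shift_add[of A k 1] shift_1[of A] by simp

lemma hom_vanishes_shift_both:
  assumes "A \<in> Ob C" "B \<in> Ob C"
  shows "hom_vanishes C (shift C k A) (shift C k B) \<longleftrightarrow> hom_vanishes C A B"
proof (induction k rule: int_induct[where k = 0])
  case base
  show ?case by simp
next
  case (step1 i)
  then show ?case
    using hom_vanishes_Sh[OF shift_in_Ob[OF assms(1)] shift_in_Ob[OF assms(2)]] assms
    by (simp add: shift_plus1)
next
  case (step2 i)
  then show ?case
    using hom_vanishes_Sh[OF shift_in_Ob[OF assms(1)] shift_in_Ob[OF assms(2)], of "i - 1" "i - 1"] assms
    by (simp add: shift_minus1)
qed

lemma hom_vanishes_shift:
  assumes "A \<in> Ob C" "B \<in> Ob C"
  shows "hom_vanishes C (shift C j A) (shift C k B) \<longleftrightarrow> hom_vanishes C A (shift C (k - j) B)"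
  using hom_vanishes_shift_both[OF assms(1) shift_in_Ob[OF assms(2)], of j "k - j"]
    shift_add[OF assms(2), of j "k - j"] by simp

lemma perp_shift:
  assumes "A \<in> Ob C" "B \<in> Ob C"
  shows "shift C p B \<in> perp C I A \<longleftrightarrow> (\<forall>k\<in>I. hom_vanishes C A (shift C (k + p) B))"
  using shift_in_Ob[OF assms(2)] shift_add[OF assms(2)] by (simp add: perp_def)

lemma perp_cone:
  assumes t: "(f, g, h) \<in> Tri C" and g: "g \<in> Hom C B D" and h: "h \<in> Hom C D (Sh C A)"
    and Ob: "Q \<in> Ob C" "A \<in> Ob C" and B: "B \<in> perp C I Q" and A: "Sh C A \<in> perp C I Q"
  shows "D \<in> perp C I Q"
proof -
  have D: "D \<in> Ob C" "B \<in> Ob C" using HomD[OF g] by auto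
  have "hom_vanishes C Q (shift C k D)" if k: "k \<in> I" for k
  proof -
    have v: "hom_vanishes C Q (shift C k W) \<longleftrightarrow> hom_vanishes C (shift C (- k) Q) W" if "W \<in> Ob C" for W
      using hom_vanishes_shift[OF Ob(1) that, of "- k" 0] by simp
    show ?thesis
      using hom_vanishes_cone[OF t g h shift_in_Ob[OF Ob(1)], of "-k"] A B k
        v[OF D(1)] v[OF D(2)] v[OF Sh_in_Ob[OF Ob(2)]] by (simp add: perp_def)
  qed
  then show ?thesis using D by (simp add: perp_def)
qed

lemma perp_Sh:
  assumes "A \<in> perp C I Q" "\<And>k. k \<in> I \<Longrightarrow> k + 1 \<in> I"
  shows "Sh C A \<in> perp C I Q"
proof -
  have A: "A \<in> Ob C" using assms(1) by (simp add: perp_def)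
  show ?thesis using assms Sh_in_Ob[OF A] shift_Sh[OF A] by (simp add: perp_def)
qed

lemma coproduct_Sh:
  assumes S: "is_coproduct C I A S \<iota>" and A: "\<And>i. i \<in> I \<Longrightarrow> A i \<in> Ob C"
  shows "is_coproduct C I (\<lambda>i. Sh C (A i)) (Sh C S) (\<lambda>i. ShA C (\<iota> i))"
  unfolding is_coproduct_def
proof (intro conjI ballI allI impI)
  note SO = is_coproductD(1)[OF S]
  show "Sh C S \<in> Ob C" using SO by (rule Sh_in_Ob)
  show "\<And>i. i \<in> I \<Longrightarrow> ShA C (\<iota> i) \<in> Hom C (Sh C (A i)) (Sh C S)"
    using is_coproductD(2)[OF S] by (rule ShA_in_Hom)
  fix T f assume T: "T \<in> Ob C" and f: "\<forall>i\<in>I. f i \<in> Hom C (Sh C (A i)) T"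
  obtain T' where T': "T' \<in> Ob C" "T = Sh C T'" using T by (rule Sh_surj)
  have "\<forall>i\<in>I. \<exists>g. g \<in> Hom C (A i) T' \<and> f i = ShA C g"
    using f ShA_surj[OF A T'(1)] T'(2) by metis
  then obtain g where g: "\<And>i. i \<in> I \<Longrightarrow> g i \<in> Hom C (A i) T'" "\<And>i. i \<in> I \<Longrightarrow> f i = ShA C (g i)"
    by metis
  obtain h where h: "h \<in> Hom C S T'" "\<And>i. i \<in> I \<Longrightarrow> h \<cdot> \<iota> i = g i"
    using coproduct_map[OF S T'(1) g(1)] by blast
  show "\<exists>!k. k \<in> Hom C (Sh C S) T \<and> (\<forall>i\<in>I. k \<cdot> ShA C (\<iota> i) = f i)"
  proof (rule ex1I[of _ "ShA C h"])
    show "ShA C h \<in> Hom C (Sh C S) T \<and> (\<forall>i\<in>I. ShA C h \<cdot> ShA C (\<iota> i) = f i)"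
      using ShA_in_Hom[OF h(1)] T'(2) g h ShA_Comp[OF is_coproductD(2)[OF S] h(1)] by simp
    fix k assume k: "k \<in> Hom C (Sh C S) T \<and> (\<forall>i\<in>I. k \<cdot> ShA C (\<iota> i) = f i)"
    then have "k \<in> Hom C (Sh C S) (Sh C T')" using T'(2) by simp
    then obtain k' where k': "k' \<in> Hom C S T'" "k = ShA C k'"
      using ShA_surj[OF SO T'(1)] by blast
    have "k' = h"
    proof (rule coproduct_ext[OF S k'(1) h(1)])
      fix i assume i: "i \<in> I"
      have "ShA C (k' \<cdot> \<iota> i) = ShA C (h \<cdot> \<iota> i)"
        using ShA_Comp[OF is_coproductD(2)[OF S i] k'(1)] k k'(2) i g(2) h(2) by simp
      then show "k' \<cdot> \<iota> i = h \<cdot> \<iota> i"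
        using ShA_inj Comp_in_Hom is_coproductD(2)[OF S i] k'(1) h(1) by metis
    qed
    then show "k = ShA C h" using k'(2) by simp
  qed
qed

lemma coproduct_unSh:
  assumes S: "is_coproduct C I (\<lambda>i. Sh C (A i)) (Sh C S) \<iota>" and A: "\<And>i. i \<in> I \<Longrightarrow> A i \<in> Ob C"
    and SO: "S \<in> Ob C"
  shows "\<exists>\<iota>'. is_coproduct C I A S \<iota>'"
proof -
  have "\<forall>i\<in>I. \<exists>g. g \<in> Hom C (A i) S \<and> \<iota> i = ShA C g"
    using is_coproductD(2)[OF S] ShA_surj[OF A SO] by metis
  then obtain j where j: "\<And>i. i \<in> I \<Longrightarrow> j i \<in> Hom C (A i) S" "\<And>i. i \<in> I \<Longrightarrow> \<iota> i = ShA C (j i)"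
    by metis
  have "is_coproduct C I A S j"
    unfolding is_coproduct_def
  proof (intro conjI ballI allI impI)
    show "S \<in> Ob C" by (fact SO)
    show "\<And>i. i \<in> I \<Longrightarrow> j i \<in> Hom C (A i) S" by (fact j)
    fix T f assume T: "T \<in> Ob C" and f: "\<forall>i\<in>I. f i \<in> Hom C (A i) T"
    obtain h' where h': "h' \<in> Hom C (Sh C S) (Sh C T)" "\<And>i. i \<in> I \<Longrightarrow> h' \<cdot> \<iota> i = ShA C (f i)"
      using coproduct_map[OF S Sh_in_Ob[OF T], of "\<lambda>i. ShA C (f i)"] f ShA_in_Hom by metis
    obtain h where h: "h \<in> Hom C S T" "h' = ShA C h" using ShA_surj[OF SO T h'(1)] .
    have hj: "h \<cdot> j i = f i" if i: "i \<in> I" for i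
      using ShA_inj[OF Comp_in_Hom[OF j(1)[OF i] h(1)], of "f i"] f i h'(2)[OF i] h(2) j(2)[OF i]
        ShA_Comp[OF j(1)[OF i] h(1)] by simp
    show "\<exists>!k. k \<in> Hom C S T \<and> (\<forall>i\<in>I. k \<cdot> j i = f i)"
    proof (rule ex1I[of _ h])
      show "h \<in> Hom C S T \<and> (\<forall>i\<in>I. h \<cdot> j i = f i)" using h hj by blast
      fix k assume k: "k \<in> Hom C S T \<and> (\<forall>i\<in>I. k \<cdot> j i = f i)"
      have "ShA C k = ShA C h"
      proof (rule coproduct_ext[OF S])
        show "ShA C k \<in> Hom C (Sh C S) (Sh C T)" "ShA C h \<in> Hom C (Sh C S) (Sh C T)"
          using k h by (auto intro: ShA_in_Hom)
        fix i assume i: "i \<in> I"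
        show "ShA C k \<cdot> \<iota> i = ShA C h \<cdot> \<iota> i"
          using ShA_Comp[OF j(1)[OF i]] k h(1) hj[OF i] j(2)[OF i] i by metis
      qed
      then show "k = h" using ShA_inj k h(1) by blast
    qed
  qed
  then show ?thesis by blast
qed

lemma coproduct_shift:
  assumes S: "is_coproduct C I A S \<iota>" and A: "\<And>i. i \<in> I \<Longrightarrow> A i \<in> Ob C"
  shows "\<exists>\<iota>'. is_coproduct C I (\<lambda>i. shift C k (A i)) (shift C k S) \<iota>'"
proof (induction k rule: int_induct[where k = 0])
  case base
  show ?case using S by auto
next
  case (step1 i)
  then obtain j where "is_coproduct C I (\<lambda>l. shift C i (A l)) (shift C i S) j" by blast
  from coproduct_Sh[OF this shift_in_Ob[OF A]]
  have "is_coproduct C I (\<lambda>l. shift C (i + 1) (A l)) (shift C (i + 1) S) (\<lambda>l. ShA C (j l))"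
    unfolding shift_plus1[OF is_coproductD(1)[OF S]]
    by (rule is_coproduct_cong) (simp_all add: shift_plus1[OF A])
  then show ?case by blast
next
  case (step2 i)
  then obtain j where "is_coproduct C I (\<lambda>l. shift C i (A l)) (shift C i S) j" by blast
  then have "is_coproduct C I (\<lambda>l. Sh C (shift C (i - 1) (A l))) (Sh C (shift C (i - 1) S)) j"
    unfolding shift_minus1[OF is_coproductD(1)[OF S]]
    by (rule is_coproduct_cong) (simp_all add: shift_minus1[OF A])
  then show ?case
    by (rule coproduct_unSh) (simp_all add: shift_in_Ob is_coproductD(1)[OF S] A)
qed

text \<open>Closure under coproducts of the orthogonal in degrees above \<open>0\<close> gives the same for any other bound.\<close>

lemma perp_coproducts_shift:
  fixes \<kappa> :: "'u rel"
  assumes cl: "closed_under_coproducts \<kappa> C (perp C {0<..} M)" and M: "M \<in> Ob C"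
  shows "closed_under_coproducts \<kappa> C (perp C {p<..} M)"
  unfolding closed_under_coproducts_def
proof (intro allI impI, elim conjE)
  fix I :: "'u set" and A S \<iota>
  assume I: "small \<kappa> I" and A: "\<forall>i\<in>I. A i \<in> perp C {p<..} M" and S: "is_coproduct C I A S \<iota>"
  have AO: "\<And>i. i \<in> I \<Longrightarrow> A i \<in> Ob C" using A by (simp add: perp_def)
  note SO = is_coproductD(1)[OF S]
  obtain j where j: "is_coproduct C I (\<lambda>i. shift C p (A i)) (shift C p S) j"
    using coproduct_shift[OF S AO] by blast
  have "\<forall>i\<in>I. shift C p (A i) \<in> perp C {0<..} M"
    using A perp_shift[OF M AO] by (simp add: perp_def)
  then have "shift C p S \<in> perp C {0<..} M"
    using cl[unfolded closed_under_coproducts_def, rule_format, of I "\<lambda>i. shift C p (A i)"] I j by blast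
  then have v: "\<And>k. k > 0 \<Longrightarrow> hom_vanishes C M (shift C (k + p) S)"
    using perp_shift[OF M SO] by simp
  have "hom_vanishes C M (shift C k S)" if "k > p" for k
    using v[of "k - p"] that by simp
  then show "S \<in> perp C {p<..} M" using SO by (simp add: perp_def)
qed

lemma perp_coproducts_all:
  fixes \<kappa> :: "'u rel"
  assumes cl: "closed_under_coproducts \<kappa> C (perp C {0<..} M)" and M: "M \<in> Ob C"
  shows "closed_under_coproducts \<kappa> C (perp C UNIV M)"
proof -
  have e: "perp C UNIV M = (\<Inter>p. perp C {p<..} M)"
    using lt_ex by (fastforce simp: perp_def)
  show ?thesis
    unfolding closed_under_coproducts_def
  proof (intro allI impI, elim conjE)
    fix I :: "'u set" and A S \<iota>
    assume I: "small \<kappa> I" and A: "\<forall>i\<in>I. A i \<in> perp C UNIV M" and S: "is_coproduct C I A S \<iota>"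
    have "S \<in> perp C {p<..} M" for p
      using perp_coproducts_shift[OF cl M, of p, unfolded closed_under_coproducts_def, rule_format, of I A S \<iota>]
        I A S e by blast
    then show "S \<in> perp C UNIV M" unfolding e by blast
  qed
qed

end

section \<open>Telescopes\<close>

text \<open>
  The telescope of a sequence \<open>E\<^sub>0 \<rightarrow> E\<^sub>1 \<rightarrow> \<cdots>\<close> with arrows \<open>s\<^sub>n\<close>: the endomorphism \<open>d\<close> of the coproduct
  \<open>S\<close> of all \<open>E\<^sub>n\<close> that restricts to \<open>1 - s\<^sub>n\<close> on \<open>E\<^sub>n\<close>. In a triangulated
  category its cone is the homotopy colimit of the sequence.
\<close>

locale telescope = additive_category C
  for C :: "('o, 'm, 'z) precategory_scheme" (structure) +
  fixes E :: "nat \<Rightarrow> 'o" and s :: "nat \<Rightarrow> 'm" and S :: 'o and \<iota> :: "nat \<Rightarrow> 'm" and d :: 'm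
  assumes s: "s n \<in> Hom C (E n) (E (Suc n))"
    and S: "is_coproduct C UNIV E S \<iota>"
    and d: "d \<in> Hom C S S"
    and d_\<iota>: "d \<cdot> \<iota> n = Add C (\<iota> n) (Neg C (\<iota> (Suc n) \<cdot> s n))"
begin

lemma EOb: "E n \<in> Ob C" and SOb: "S \<in> Ob C" and \<iota>: "\<iota> n \<in> Hom C (E n) S"
  using HomD[OF s[of n]] is_coproductD[OF S] by auto

lemma S_ext:
  assumes "h \<in> Hom C S T" "h' \<in> Hom C S T" "\<And>n. h \<cdot> \<iota> n = h' \<cdot> \<iota> n"
  shows "h = h'"
  using coproduct_ext[OF S assms(1,2)] assms(3) by blast

text \<open>The projection to a component, and the endomorphism \<open>trunc N\<close> that forgets the components below
  \<open>N\<close>.\<close>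

definition proj :: "nat \<Rightarrow> 'm" where
  "proj n = (SOME h. h \<in> Hom C S (E n) \<and>
     (\<forall>m. h \<cdot> \<iota> m = (if m = n then Id C (E n) else Zero C (E m) (E n))))"

definition trunc :: "nat \<Rightarrow> 'm" where
  "trunc N = (SOME h. h \<in> Hom C S S \<and> (\<forall>m. h \<cdot> \<iota> m = (if m < N then Zero C (E m) S else \<iota> m)))"

lemma proj: "proj n \<in> Hom C S (E n)"
  and proj_\<iota>: "proj n \<cdot> \<iota> m = (if m = n then Id C (E n) else Zero C (E m) (E n))"
proof -
  have "\<exists>h. h \<in> Hom C S (E n) \<and> (\<forall>m. h \<cdot> \<iota> m = (if m = n then Id C (E n) else Zero C (E m) (E n)))"
    by (rule coproduct_map[OF S EOb[of n], of "\<lambda>m. if m = n then Id C (E n) else Zero C (E m) (E n)"])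
      (auto intro: Id_in_Hom Zero_in_Hom EOb)
  from someI_ex[OF this]
  show "proj n \<in> Hom C S (E n)" "proj n \<cdot> \<iota> m = (if m = n then Id C (E n) else Zero C (E m) (E n))"
    unfolding proj_def by blast+
qed

lemma trunc: "trunc N \<in> Hom C S S"
  and trunc_\<iota>: "trunc N \<cdot> \<iota> m = (if m < N then Zero C (E m) S else \<iota> m)"
proof -
  have "\<exists>h. h \<in> Hom C S S \<and> (\<forall>m. h \<cdot> \<iota> m = (if m < N then Zero C (E m) S else \<iota> m))"
    by (rule coproduct_map[OF S SOb, of "\<lambda>m. if m < N then Zero C (E m) S else \<iota> m"])
      (auto intro: Zero_in_Hom EOb SOb \<iota>)
  from someI_ex[OF this]
  show "trunc N \<in> Hom C S S" "trunc N \<cdot> \<iota> m = (if m < N then Zero C (E m) S else \<iota> m)"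
    unfolding trunc_def by blast+
qed

lemma trunc_0: "trunc 0 = Id C S"
  by (rule S_ext[OF trunc Id_in_Hom[OF SOb]]) (simp add: trunc_\<iota> Id_left[OF \<iota>])

lemma trunc_trunc:
  assumes "N \<le> M"
  shows "trunc M \<cdot> trunc N = trunc M"
proof (rule S_ext[OF Comp_in_Hom[OF trunc trunc] trunc])
  fix n
  have "trunc M \<cdot> trunc N \<cdot> \<iota> n = trunc M \<cdot> (trunc N \<cdot> \<iota> n)"
    using Comp_assoc[OF \<iota> trunc trunc] by simp
  also have "\<dots> = trunc M \<cdot> \<iota> n"
    using assms Comp_Zero_right[OF trunc EOb] by (simp add: trunc_\<iota>)
  finally show "trunc M \<cdot> trunc N \<cdot> \<iota> n = trunc M \<cdot> \<iota> n" .
qed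

lemma proj_trunc: "proj N \<cdot> trunc N = proj N"
proof (rule S_ext[OF Comp_in_Hom[OF trunc proj] proj])
  fix n
  have "proj N \<cdot> trunc N \<cdot> \<iota> n = proj N \<cdot> (trunc N \<cdot> \<iota> n)"
    using Comp_assoc[OF \<iota> trunc proj] by simp
  also have "\<dots> = proj N \<cdot> \<iota> n"
    using Comp_Zero_right[OF proj EOb] by (simp add: trunc_\<iota> proj_\<iota>)
  finally show "proj N \<cdot> trunc N \<cdot> \<iota> n = proj N \<cdot> \<iota> n" .
qed

lemma trunc_split: "trunc N = Add C (\<iota> N \<cdot> proj N) (trunc (Suc N))"
proof (rule S_ext[OF trunc Add_in_Hom[OF Comp_in_Hom[OF proj \<iota>] trunc]])
  fix n
  note ip = Comp_in_Hom[OF proj[of N] \<iota>[of N]]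
  have "Add C (\<iota> N \<cdot> proj N) (trunc (Suc N)) \<cdot> \<iota> n = Add C (\<iota> N \<cdot> (proj N \<cdot> \<iota> n)) (trunc (Suc N) \<cdot> \<iota> n)"
    using Comp_Add_left[OF \<iota> ip trunc] Comp_assoc[OF \<iota> proj \<iota>] by simp
  also have "\<dots> = trunc N \<cdot> \<iota> n"
    using Add_Zero[OF \<iota>[of n]] Add_Zero[OF Zero_in_Hom[OF EOb[of n] SOb]] Id_right[OF \<iota>]
      Comp_Zero_right[OF \<iota>[of N] EOb[of n]]
    by (cases "n = N") (auto simp: trunc_\<iota> proj_\<iota>)
  finally show "trunc N \<cdot> \<iota> n = Add C (\<iota> N \<cdot> proj N) (trunc (Suc N)) \<cdot> \<iota> n" by simp
qed

lemma proj_0_d: "proj 0 \<cdot> d = proj 0"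
proof (rule S_ext[OF Comp_in_Hom[OF d proj] proj])
  fix n
  note is_hom = Comp_in_Hom[OF s[of n] \<iota>]
  have "proj 0 \<cdot> d \<cdot> \<iota> n = Add C (proj 0 \<cdot> \<iota> n) (Neg C (proj 0 \<cdot> (\<iota> (Suc n) \<cdot> s n)))"
    using Comp_assoc[OF \<iota> d proj] d_\<iota> Comp_Add_right[OF \<iota> Neg_in_Hom[OF is_hom] proj] Comp_Neg_right[OF is_hom proj]
    by simp
  also have "proj 0 \<cdot> (\<iota> (Suc n) \<cdot> s n) = Zero C (E n) (E 0)"
    using Comp_assoc[OF s \<iota> proj] Comp_Zero_left[OF s EOb] by (simp add: proj_\<iota>)
  finally show "proj 0 \<cdot> d \<cdot> \<iota> n = proj 0 \<cdot> \<iota> n"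
    using Neg_Zero[OF EOb EOb] Add_Zero(1)[OF Comp_in_Hom[OF \<iota> proj]] by simp
qed

lemma proj_Suc_d: "proj (Suc n) \<cdot> d = Add C (proj (Suc n)) (Neg C (s n \<cdot> proj n))"
proof -
  note sp = Comp_in_Hom[OF proj[of n] s[of n]]
  show ?thesis
  proof (rule S_ext[OF Comp_in_Hom[OF d proj] Add_in_Hom[OF proj Neg_in_Hom[OF sp]]])
    fix m
    note is_hom = Comp_in_Hom[OF s[of m] \<iota>]
    have "proj (Suc n) \<cdot> d \<cdot> \<iota> m =
        Add C (proj (Suc n) \<cdot> \<iota> m) (Neg C (proj (Suc n) \<cdot> (\<iota> (Suc m) \<cdot> s m)))"
      using Comp_assoc[OF \<iota> d proj] d_\<iota> Comp_Add_right[OF \<iota> Neg_in_Hom[OF is_hom] proj]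
        Comp_Neg_right[OF is_hom proj] by simp
    also have "proj (Suc n) \<cdot> (\<iota> (Suc m) \<cdot> s m) = s n \<cdot> (proj n \<cdot> \<iota> m)"
      using Comp_assoc[OF s[of m] \<iota> proj] Comp_Zero_left[OF s[of m] EOb] Id_left[OF s[of n]]
        Id_right[OF s[of n]] Comp_Zero_right[OF s[of n] EOb] by (simp add: proj_\<iota>)
    also have "Add C (proj (Suc n) \<cdot> \<iota> m) (Neg C (s n \<cdot> (proj n \<cdot> \<iota> m))) =
        Add C (proj (Suc n)) (Neg C (s n \<cdot> proj n)) \<cdot> \<iota> m"
      using Comp_Add_left[OF \<iota> proj Neg_in_Hom[OF sp]] Comp_Neg_left[OF \<iota> sp] Comp_assoc[OF \<iota> proj s]
      by simp
    finally show "proj (Suc n) \<cdot> d \<cdot> \<iota> m = Add C (proj (Suc n)) (Neg C (s n \<cdot> proj n)) \<cdot> \<iota> m" .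
  qed
qed

lemma proj_0_d_comp: "x \<in> Hom C Q S \<Longrightarrow> proj 0 \<cdot> (d \<cdot> x) = proj 0 \<cdot> x"
  using Comp_assoc[OF _ d proj] proj_0_d by simp

lemma proj_Suc_d_comp:
  assumes x: "x \<in> Hom C Q S"
  shows "proj (Suc n) \<cdot> (d \<cdot> x) = Add C (proj (Suc n) \<cdot> x) (Neg C (s n \<cdot> (proj n \<cdot> x)))"
proof -
  note sp = Comp_in_Hom[OF proj[of n] s[of n]]
  show ?thesis
    using Comp_assoc[OF x d proj] proj_Suc_d Comp_Add_left[OF x proj Neg_in_Hom[OF sp]]
      Comp_Neg_left[OF x sp] Comp_assoc[OF x proj s] by simp
qed

text \<open>
  Composition with \<open>d\<close> is injective on maps into \<open>S\<close> that meet only finitely many components: \<open>d x = 0\<close>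
  forces the components of \<open>x\<close> to vanish one after the other, starting from component \<open>0\<close>.
\<close>

lemma d_inj:
  assumes x: "x \<in> Hom C Q S" and fin: "trunc N \<cdot> x = Zero C Q S" and dx: "d \<cdot> x = Zero C Q S"
  shows "x = Zero C Q S"
proof -
  have Q: "Q \<in> Ob C" using HomD[OF x] by simp
  have px: "proj n \<cdot> x = Zero C Q (E n)" for n
  proof (induction n)
    case 0
    show ?case using proj_0_d_comp[OF x] dx Comp_Zero_right[OF proj Q] by simp
  next
    case (Suc n)
    have sp: "s n \<cdot> (proj n \<cdot> x) \<in> Hom C Q (E (Suc n))"
      using x by (intro Comp_in_Hom[OF _ s] Comp_in_Hom[OF _ proj])
    have "proj (Suc n) \<cdot> x = s n \<cdot> (proj n \<cdot> x)"
      using proj_Suc_d_comp[OF x, of n] dx Comp_Zero_right[OF proj Q]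
        diff_eq_Zero[OF Comp_in_Hom[OF x proj] sp] by simp
    then show ?case using Suc Comp_Zero_right[OF s Q] by simp
  qed
  have "trunc n \<cdot> x = x" for n
  proof (induction n)
    case 0
    show ?case using trunc_0 Id_left[OF x] by simp
  next
    case (Suc n)
    have "trunc n \<cdot> x = Add C (\<iota> n \<cdot> (proj n \<cdot> x)) (trunc (Suc n) \<cdot> x)"
      using trunc_split[of n] Comp_Add_left[OF x Comp_in_Hom[OF proj \<iota>] trunc] Comp_assoc[OF x proj \<iota>]
      by simp
    then show ?case
      using Suc px Comp_Zero_right[OF \<iota> Q] Add_Zero(2)[OF Comp_in_Hom[OF x trunc]] by simp
  qed
  then show ?thesis using fin by metis
qed

text \<open>
  Such a map is also in the image of \<open>d\<close> if its source has no nonzero maps to the later objects: modulo the image of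
  \<open>d\<close>, a map to component \<open>n\<close> can be pushed to component \<open>n + 1\<close>, until it becomes zero.
\<close>

lemma d_surj:
  assumes x: "x \<in> Hom C Q S" and fin: "trunc N \<cdot> x = Zero C Q S"
    and v: "\<And>n. n \<ge> N0 \<Longrightarrow> hom_vanishes C Q (E n)"
  obtains y where "y \<in> Hom C Q S" "d \<cdot> y = x"
proof -
  have Q: "Q \<in> Ob C" using HomD[OF x] by simp
  note zQ = Zero_in_Hom[OF Q SOb]
  define R where "R = {x. \<exists>y \<in> Hom C Q S. d \<cdot> y = x}"
  have R_add: "Add C a b \<in> R" if ab: "a \<in> R" "b \<in> R" for a b
    using ab Add_in_Hom Comp_Add_right[OF _ _ d] unfolding R_def by blast
  have R_zero: "Zero C Q S \<in> R" using zQ Comp_Zero_right[OF d Q] by (auto simp: R_def)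
  have comp: "\<iota> n \<cdot> a \<in> R" if a: "a \<in> Hom C Q (E n)" for n a
    using a
  proof (induction "N0 - n" arbitrary: n a)
    case 0
    then have "hom_vanishes C Q (E n)" using v by simp
    then have "a = Zero C Q (E n)" using 0 hom_vanishesD by blast
    then show ?case using Comp_Zero_right[OF \<iota> Q] R_zero by simp
  next
    case (Suc k)
    let ?b = "\<iota> (Suc n) \<cdot> (s n \<cdot> a)"
    note ia = Comp_in_Hom[OF Suc.prems \<iota>] and sa = Comp_in_Hom[OF Suc.prems s]
    note b = Comp_in_Hom[OF sa \<iota>]
    have bR: "?b \<in> R" using Suc sa by simp
    have is_hom: "\<iota> (Suc n) \<cdot> s n \<in> Hom C (E n) S" using s \<iota> by (rule Comp_in_Hom)
    have "d \<cdot> (\<iota> n \<cdot> a) = Add C (\<iota> n \<cdot> a) (Neg C ?b)"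
      using Comp_assoc[OF Suc.prems \<iota> d] d_\<iota> Comp_Add_left[OF Suc.prems \<iota> Neg_in_Hom[OF is_hom]]
        Comp_Neg_left[OF Suc.prems is_hom] Comp_assoc[OF Suc.prems s \<iota>] by simp
    then have "Add C (d \<cdot> (\<iota> n \<cdot> a)) ?b = \<iota> n \<cdot> a"
      using Add_assoc[OF ia Neg_in_Hom[OF b] b] Add_commute[OF Neg_in_Hom[OF b] b] Add_Neg[OF b]
        Add_Zero(1)[OF ia] by simp
    moreover have "d \<cdot> (\<iota> n \<cdot> a) \<in> R" using ia by (auto simp: R_def)
    ultimately show ?case using R_add bR by metis
  qed
  have "\<exists>r \<in> R. r \<in> Hom C Q S \<and> x = Add C r (trunc n \<cdot> x)" for n
  proof (induction n)
    case 0
    show ?case using R_zero zQ trunc_0 Id_left[OF x] Add_Zero(2)[OF x] by force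
  next
    case (Suc n)
    then obtain r where r: "r \<in> R" "r \<in> Hom C Q S" "x = Add C r (trunc n \<cdot> x)" by blast
    let ?t = "\<iota> n \<cdot> (proj n \<cdot> x)"
    note px = Comp_in_Hom[OF x proj[of n]]
    note t = Comp_in_Hom[OF px \<iota>]
    have "trunc n \<cdot> x = Add C ?t (trunc (Suc n) \<cdot> x)"
      using trunc_split[of n] Comp_Add_left[OF x Comp_in_Hom[OF proj \<iota>] trunc] Comp_assoc[OF x proj \<iota>]
      by simp
    then have "x = Add C (Add C r ?t) (trunc (Suc n) \<cdot> x)"
      using r(3) Add_assoc[OF r(2) t Comp_in_Hom[OF x trunc]] by simp
    then show ?case using R_add[OF r(1) comp[OF px]] Add_in_Hom[OF r(2) t] by blast
  qed
  then obtain r where r: "r \<in> R" "r \<in> Hom C Q S" "x = Add C r (Zero C Q S)"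
    using fin by metis
  then have "x \<in> R" using Add_Zero(1)[OF r(2)] by simp
  then show ?thesis using that by (auto simp: R_def)
qed

text \<open>
  If \<open>\<iota>\<^sub>0 f = d y\<close>, then the \<open>n\<close>-th component of \<open>y\<close> is the image of \<open>f\<close> in \<open>E\<^sub>n\<close>. When \<open>y\<close> meets only finitely
  many components, \<open>f\<close> therefore becomes zero at a finite stage. So \<open>f\<close> is zero if no \<open>s\<^sub>n\<close> kills a nonzero map
  from \<open>Q\<close>.
\<close>

lemma d_image_\<iota>_0:
  assumes f: "f \<in> Hom C Q (E 0)" and y: "y \<in> Hom C Q S" and dy: "d \<cdot> y = \<iota> 0 \<cdot> f"
    and fin: "trunc N \<cdot> y = Zero C Q S"
    and inj: "\<And>n x. x \<in> Hom C Q (E n) \<Longrightarrow> s n \<cdot> x = Zero C Q (E (Suc n)) \<Longrightarrow> x = Zero C Q (E n)"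
  shows "f = Zero C Q (E 0)"
proof -
  have Q: "Q \<in> Ob C" using HomD[OF f] by simp
  note py = Comp_in_Hom[OF y proj]
  have if0: "proj n \<cdot> (\<iota> 0 \<cdot> f) = (if n = 0 then f else Zero C Q (E n))" for n
    using Comp_assoc[OF f \<iota> proj] Id_left[OF f] Comp_Zero_left[OF f EOb] by (simp add: proj_\<iota>)
  have p0: "proj 0 \<cdot> y = f" using proj_0_d_comp[OF y] dy if0[of 0] by simp
  have pS: "proj (Suc n) \<cdot> y = s n \<cdot> (proj n \<cdot> y)" for n
    using proj_Suc_d_comp[OF y, of n] dy if0[of "Suc n"] diff_eq_Zero[OF py Comp_in_Hom[OF py s]] by simp
  have "proj N \<cdot> y = proj N \<cdot> (trunc N \<cdot> y)" using Comp_assoc[OF y trunc proj] proj_trunc by simp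
  then have pN: "proj N \<cdot> y = Zero C Q (E N)" using fin Comp_Zero_right[OF proj Q] by simp
  have "proj (N - k) \<cdot> y = Zero C Q (E (N - k))" for k
  proof (induction k)
    case 0
    show ?case using pN by simp
  next
    case (Suc k)
    show ?case
    proof (cases "k < N")
      case True
      then have e: "Suc (N - Suc k) = N - k" by simp
      have "s (N - Suc k) \<cdot> (proj (N - Suc k) \<cdot> y) = Zero C Q (E (Suc (N - Suc k)))"
        using pS[of "N - Suc k"] Suc unfolding e by simp
      then show ?thesis using inj[OF py] by blast
    next
      case False
      then show ?thesis using Suc by simp
    qed
  qed
  from this[of N] show ?thesis using p0 by simp
qed

text \<open>Two sources of finiteness: vanishing on a tail of the coproduct, and compactness.\<close>

lemma trunc_vanishes:
  assumes T: "is_coproduct C UNIV (\<lambda>n. E (n + N)) T \<tau>" and v: "hom_vanishes C Q T"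
    and x: "x \<in> Hom C Q S"
  shows "trunc N \<cdot> x = Zero C Q S"
proof -
  have Q: "Q \<in> Ob C" using HomD[OF x] by simp
  note TO = is_coproductD(1)[OF T] and \<tau> = is_coproductD(2)[OF T UNIV_I]
  have \<tau>': "\<tau> (n - N) \<in> Hom C (E n) T" if "\<not> n < N" for n using \<tau>[of "n - N"] that by simp
  have fam: "(if n < N then Zero C (E n) T else \<tau> (n - N)) \<in> Hom C (E n) T" for n
    using Zero_in_Hom[OF EOb TO] \<tau>' by simp
  have "\<exists>p. p \<in> Hom C S T \<and> (\<forall>n. p \<cdot> \<iota> n = (if n < N then Zero C (E n) T else \<tau> (n - N)))"
    by (rule coproduct_map[OF S TO, of "\<lambda>n. if n < N then Zero C (E n) T else \<tau> (n - N)"])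
      (use fam in auto)
  then obtain p where p: "p \<in> Hom C S T"
    "\<And>n. p \<cdot> \<iota> n = (if n < N then Zero C (E n) T else \<tau> (n - N))" by blast
  have "\<exists>e. e \<in> Hom C T S \<and> (\<forall>n. e \<cdot> \<tau> n = \<iota> (n + N))"
    by (rule coproduct_map[OF T SOb, of "\<lambda>n. \<iota> (n + N)"]) (use \<iota> in auto)
  then obtain e where e: "e \<in> Hom C T S" "\<And>n. e \<cdot> \<tau> n = \<iota> (n + N)" by blast
  have "e \<cdot> p = trunc N"
  proof (rule S_ext[OF Comp_in_Hom[OF p(1) e(1)] trunc])
    fix n
    show "e \<cdot> p \<cdot> \<iota> n = trunc N \<cdot> \<iota> n"
      using Comp_assoc[OF \<iota> p(1) e(1), of n] p(2)[of n] e(2)[of "n - N"] Comp_Zero_right[OF e(1) EOb]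
      by (cases "n < N") (simp_all add: trunc_\<iota>)
  qed
  then show ?thesis
    using Comp_assoc[OF x p(1) e(1)] hom_vanishesD[OF v Comp_in_Hom[OF x p(1)]] Comp_Zero_right[OF e(1) Q]
    by simp
qed

lemma trunc_compact:
  fixes \<kappa> :: "'u rel"
  assumes \<kappa>: "size_cardinal \<kappa>" and M: "compact_object \<kappa> C M" and x: "x \<in> Hom C M S"
  shows "\<exists>N. trunc N \<cdot> x = Zero C M S"
proof (rule compact_induct[OF \<kappa> M small_nat[OF \<kappa>] EOb S x, where P = "\<lambda>x. \<exists>N. trunc N \<cdot> x = Zero C M S"])
  have MO: "M \<in> Ob C" using HomD[OF x] by simp
  show "\<exists>N. trunc N \<cdot> Zero C M S = Zero C M S" using Comp_Zero_right[OF trunc MO] by blast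
  show "\<exists>N. trunc N \<cdot> Add C x y = Zero C M S"
    if x: "x \<in> Hom C M S" and y: "y \<in> Hom C M S" and ex: "\<exists>N. trunc N \<cdot> x = Zero C M S"
      "\<exists>N. trunc N \<cdot> y = Zero C M S" for x y
  proof -
    obtain N N' where N: "trunc N \<cdot> x = Zero C M S" "trunc N' \<cdot> y = Zero C M S" using ex by blast
    have "trunc (max N N') \<cdot> z = Zero C M S" if "z \<in> Hom C M S" "trunc K \<cdot> z = Zero C M S" "K \<le> max N N'" for z K
      using Comp_assoc[OF that(1) trunc trunc] trunc_trunc[OF that(3)] that(2) Comp_Zero_right[OF trunc MO]
      by metis
    from this[OF x N(1)] this[OF y N(2)]
    show ?thesis
      using Comp_Add_right[OF x y trunc] Add_Zero(1)[OF Zero_in_Hom[OF MO SOb]]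
      by (metis max.cobounded1 max.cobounded2)
  qed
  show "\<exists>N. trunc N \<cdot> (\<iota> n \<cdot> a) = Zero C M S" if a: "a \<in> Hom C M (E n)" for n a
  proof -
    have "trunc (Suc n) \<cdot> (\<iota> n \<cdot> a) = Zero C (E n) S \<cdot> a"
      using Comp_assoc[OF a \<iota> trunc] by (simp add: trunc_\<iota>)
    then show ?thesis using Comp_Zero_left[OF a SOb] by metis
  qed
qed

end

section \<open>Approximation by coproducts of a silting object\<close>

text \<open>
  Let \<open>Y\<close> be the orthogonal of \<open>\<omega>\<close> in all degrees. The object \<open>\<sigma>\<close> of \<open>Y\<close> has the two properties of a silting
  object of \<open>Y\<close> that the argument uses: it has no nonzero maps to its positive shifts, and an object of \<open>Y\<close>
  orthogonal to all shifts of \<open>\<sigma>\<close> is zero. The compact object \<open>T\<close> plays the part of \<open>j\<^sub>*\<omega>\<close>.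
\<close>

locale silting_approximation = triangulated_category C
  for C :: "('o, 'm, 'z) tricategory_scheme" (structure) +
  fixes \<kappa> :: "'u rel" and \<omega> \<sigma> T :: 'o
  assumes size: "size_cardinal \<kappa>"
    and loc_small: "locally_small \<kappa> C"
    and coproducts: "has_small_coproducts \<kappa> C"
    and \<omega>_Ob: "\<omega> \<in> Ob C"
    and \<omega>_coproducts: "closed_under_coproducts \<kappa> C (perp C UNIV \<omega>)"
    and \<sigma>_\<omega>: "\<sigma> \<in> perp C UNIV \<omega>"
    and \<sigma>_\<sigma>: "\<sigma> \<in> perp C {0<..} \<sigma>"
    and \<sigma>_coproducts: "closed_under_coproducts \<kappa> C (perp C {0<..} \<sigma>)"
    and \<sigma>_generates: "\<And>H. H \<in> perp C UNIV \<omega> \<Longrightarrow> H \<in> perp C UNIV \<sigma> \<Longrightarrow> hom_vanishes C H H"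
    and T_compact: "compact_object \<kappa> C T"
    and T_\<sigma>: "\<And>k. k \<ge> 2 \<Longrightarrow> hom_vanishes C T (shift C k \<sigma>)"
begin

lemma \<sigma>_Ob: "\<sigma> \<in> Ob C" and T_Ob: "T \<in> Ob C"
  using \<sigma>_\<sigma> T_compact by (auto simp: perp_def compact_object_def)

text \<open>The shift by \<open>p\<close> of the aisle of \<open>\<sigma>\<close> in \<open>Y\<close>, as a class of objects of the ambient category.\<close>

definition aisle_shift :: "int \<Rightarrow> 'o set" where
  "aisle_shift p = perp C {- p<..} \<sigma> \<inter> perp C UNIV \<omega>"

lemma aisle_shift_Ob: "E \<in> aisle_shift p \<Longrightarrow> E \<in> Ob C"
  by (simp add: aisle_shift_def perp_def)

lemma aisle_shift_vanishes:
  assumes "E \<in> aisle_shift p" "j < p"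
  shows "hom_vanishes C (shift C j \<sigma>) E"
  using hom_vanishes_shift[OF \<sigma>_Ob aisle_shift_Ob[OF assms(1)], of j 0] assms
  by (simp add: aisle_shift_def perp_def)

lemma shift_aisle:
  assumes "E \<in> aisle_shift 0"
  shows "shift C p E \<in> aisle_shift p"
  unfolding aisle_shift_def Int_iff perp_shift[OF \<sigma>_Ob aisle_shift_Ob[OF assms]]
    perp_shift[OF \<omega>_Ob aisle_shift_Ob[OF assms]]
  using assms by (simp add: aisle_shift_def perp_def)

lemma aisle_shift_mono: "p \<le> q \<Longrightarrow> aisle_shift q \<subseteq> aisle_shift p"
  by (auto simp: aisle_shift_def perp_def)

lemma aisle_shift_coproduct:
  assumes "small \<kappa> I" "is_coproduct C I A S \<iota>" "\<And>i. i \<in> I \<Longrightarrow> A i \<in> aisle_shift p"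
  shows "S \<in> aisle_shift p"
proof -
  have "S \<in> perp C {- p<..} \<sigma>"
    using assms(3) by (intro closed_under_coproductsD[OF size perp_coproducts_shift[OF \<sigma>_coproducts \<sigma>_Ob] assms(1,2)])
      (simp add: aisle_shift_def)
  moreover have "S \<in> perp C UNIV \<omega>"
    using assms(3) by (intro closed_under_coproductsD[OF size \<omega>_coproducts assms(1,2)])
      (simp add: aisle_shift_def)
  ultimately show ?thesis by (simp add: aisle_shift_def)
qed

text \<open>
  Let \<open>f\<close> be the universal map to \<open>E\<close> from a coproduct of copies of \<open>\<sigma>[p]\<close>. Its cone lies one step deeper in
  the aisle: as every map \<open>\<sigma>[p] \<rightarrow> E\<close> factors through \<open>f\<close>, the cone has one more vanishing Hom group.
\<close>

lemma approximation:
  assumes E: "E \<in> aisle_shift p"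
  obtains J :: "'m set" and F \<iota> f E' s h where
    "small \<kappa> J" "is_coproduct C J (\<lambda>_. shift C p \<sigma>) F \<iota>" "(f, s, h) \<in> Tri C"
    "f \<in> Hom C F E" "s \<in> Hom C E E'" "E' \<in> aisle_shift (p + 1)"
proof -
  note EO = aisle_shift_Ob[OF E]
  note \<sigma>p = shift_in_Ob[OF \<sigma>_Ob, of p]
  define J where "J = Hom C (shift C p \<sigma>) E"
  have J: "small \<kappa> J" using loc_small EO \<sigma>p by (simp add: locally_small_def J_def)
  obtain F \<iota> where F: "is_coproduct C J (\<lambda>_. shift C p \<sigma>) F \<iota>"
    using ex_small_coproduct[OF size coproducts J, of "\<lambda>_. shift C p \<sigma>"] \<sigma>p by blast
  note FO = is_coproductD(1)[OF F]
  have "\<exists>f. f \<in> Hom C F E \<and> (\<forall>a\<in>J. f \<cdot> \<iota> a = a)"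
    by (rule coproduct_map[OF F EO, of "\<lambda>a. a"]) (auto simp: J_def)
  then obtain f where f: "f \<in> Hom C F E" "\<And>a. a \<in> J \<Longrightarrow> f \<cdot> \<iota> a = a" by blast
  obtain s h where t: "(f, s, h) \<in> Tri C" using TR1_ex HomD(1)[OF f(1)] by blast
  obtain E' where s: "s \<in> Hom C E E'" and h: "h \<in> Hom C E' (Sh C F)"
    by (rule TriD[OF t]) (use HomD[OF f(1)] in \<open>auto simp: Hom_def\<close>)
  have E'O: "E' \<in> Ob C" using HomD[OF s] by simp
  have F': "F \<in> aisle_shift p"
  proof (rule aisle_shift_coproduct[OF J F])
    show "shift C p \<sigma> \<in> aisle_shift p"
      using shift_aisle[of \<sigma> p] \<sigma>_\<sigma> \<sigma>_\<omega> by (simp add: aisle_shift_def)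
  qed
  have \<omega>E': "E' \<in> perp C UNIV \<omega>"
    using E F' perp_Sh[of F UNIV \<omega>]
    by (intro perp_cone[OF t s h \<omega>_Ob FO]) (auto simp: aisle_shift_def)
  have \<sigma>E': "E' \<in> perp C {- p<..} \<sigma>"
    using E F' perp_Sh[of F "{- p<..}" \<sigma>]
    by (intro perp_cone[OF t s h \<sigma>_Ob FO]) (auto simp: aisle_shift_def)
  have "hom_vanishes C (shift C p \<sigma>) E'"
  proof (rule hom_vanishesI[OF \<sigma>p E'O])
    fix x assume x: "x \<in> Hom C (shift C p \<sigma>) E'"
    have "hom_vanishes C (shift C p \<sigma>) (Sh C F)"
      using aisle_shift_vanishes[OF F', of "p - 1"]
        hom_vanishes_Sh[OF shift_in_Ob[OF \<sigma>_Ob] FO, of "p - 1"] shift_minus1[OF \<sigma>_Ob, of p] by simp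
    then have "h \<cdot> x = Zero C (shift C p \<sigma>) (Sh C F)"
      using Comp_in_Hom[OF x h] hom_vanishesD by blast
    then obtain y where y: "y \<in> Hom C (shift C p \<sigma>) E" "s \<cdot> y = x"
      using Tri_exact_right[OF Tri_rotate[OF t] s h x] by blast
    have yJ: "y \<in> J" using y(1) by (simp add: J_def)
    have "x = (s \<cdot> f) \<cdot> \<iota> y"
      using y(2) f(2)[OF yJ] Comp_assoc[OF is_coproductD(2)[OF F yJ] f(1) s] by simp
    then show "x = Zero C (shift C p \<sigma>) E'"
      using Tri_comp_zero[OF t f(1) s] Comp_Zero_left[OF is_coproductD(2)[OF F yJ] E'O] by simp
  qed
  then have "hom_vanishes C \<sigma> (shift C (- p) E')"
    using hom_vanishes_shift[OF \<sigma>_Ob E'O, of p 0] by simp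
  moreover have "{- (p + 1)<..} = insert (- p) {- p<..}" by auto
  ultimately have "E' \<in> aisle_shift (p + 1)"
    using \<omega>E' \<sigma>E' by (auto simp: aisle_shift_def perp_def)
  then show ?thesis using that J F t f(1) s by blast
qed

text \<open>For \<open>p \<ge> 2\<close> the fibre of \<open>E \<rightarrow> E'\<close> receives no nonzero map from \<open>T\<close>, by compactness.\<close>

lemma approximation_mono:
  assumes E: "E \<in> aisle_shift p" and p: "p \<ge> 2"
  shows "\<exists>E' s. s \<in> Hom C E E' \<and> E' \<in> aisle_shift (p + 1) \<and>
    (\<forall>x \<in> Hom C T E. s \<cdot> x = Zero C T E' \<longrightarrow> x = Zero C T E)"
proof -
  obtain J :: "'m set" and F \<iota> f E' s h where J: "small \<kappa> J"
    and F: "is_coproduct C J (\<lambda>_. shift C p \<sigma>) F \<iota>" and t: "(f, s, h) \<in> Tri C"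
    and f: "f \<in> Hom C F E" and s: "s \<in> Hom C E E'" and E': "E' \<in> aisle_shift (p + 1)"
    using approximation[OF E] .
  have "x = Zero C T E" if x: "x \<in> Hom C T E" and sx: "s \<cdot> x = Zero C T E'" for x
  proof -
    obtain y where y: "y \<in> Hom C T F" "f \<cdot> y = x" using Tri_exact_right[OF t f s x sx] .
    have "y = Zero C T F"
    proof (rule compact_induct[OF size T_compact J shift_in_Ob[OF \<sigma>_Ob] F y(1)])
      show "Add C u v = Zero C T F" if "u = Zero C T F" "v = Zero C T F" for u v
        using that Add_Zero[OF Zero_in_Hom[OF T_Ob is_coproductD(1)[OF F]]] by simp
      show "\<iota> i \<cdot> a = Zero C T F" if "i \<in> J" "a \<in> Hom C T (shift C p \<sigma>)" for i a
        using hom_vanishesD[OF T_\<sigma>[OF p] that(2)] Comp_Zero_right[OF is_coproductD(2)[OF F that(1)] T_Ob]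
        by simp
    qed simp
    then show ?thesis using y(2) Comp_Zero_right[OF f T_Ob] by simp
  qed
  then show ?thesis using s E' by blast
qed

text \<open>
  Iterating the approximation gives a sequence \<open>E\<^sub>0 \<rightarrow> E\<^sub>1 \<rightarrow> \<cdots>\<close> with \<open>E\<^sub>n\<close> in the aisle shifted by \<open>k + n\<close>. Its
  homotopy colimit \<open>H\<close> is orthogonal to all shifts of \<open>\<sigma>\<close>, hence zero. A map \<open>T \<rightarrow> E\<^sub>0\<close> thus becomes zero at a
  finite stage, and all transition maps are injective on \<open>Hom(T, -)\<close>. Note that \<open>\<sigma>\<close> need not be
  compact: the finiteness needed for maps from its shifts comes from the tails of the sequence.
\<close>

lemma T_vanishes:
  assumes E0: "E0 \<in> aisle_shift k" and k: "k \<ge> 2"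
  shows "hom_vanishes C T E0"
proof (rule hom_vanishesI[OF T_Ob aisle_shift_Ob[OF E0]])
  fix f assume f: "f \<in> Hom C T E0"
  define R where "R E E' s \<longleftrightarrow> s \<in> Hom C E E' \<and>
    (\<forall>x \<in> Hom C T E. s \<cdot> x = Zero C T E' \<longrightarrow> x = Zero C T E)" for E E' s
  have "\<exists>E. \<forall>n. (E n \<in> aisle_shift (k + int n) \<and> (n = 0 \<longrightarrow> E n = E0)) \<and>
      (\<exists>s. R (E n) (E (Suc n)) s)"
  proof (rule dependent_nat_choice)
    show "\<exists>x. x \<in> aisle_shift (k + int 0) \<and> (0 = 0 \<longrightarrow> x = E0)" using E0 by simp
  next
    fix x and n :: nat
    assume "x \<in> aisle_shift (k + int n) \<and> (n = 0 \<longrightarrow> x = E0)"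
    then have "\<exists>y s. y \<in> aisle_shift (k + int n + 1) \<and> R x y s"
      using approximation_mono[of x "k + int n"] k unfolding R_def by auto
    then show "\<exists>y. (y \<in> aisle_shift (k + int (Suc n)) \<and> (Suc n = 0 \<longrightarrow> y = E0)) \<and> (\<exists>s. R x y s)"
      by (auto simp: algebra_simps)
  qed
  then obtain E where E: "\<And>n. E n \<in> aisle_shift (k + int n)" and E_0: "E 0 = E0"
    and "\<forall>n. \<exists>s. R (E n) (E (Suc n)) s" by blast
  then obtain s where R: "\<And>n. R (E n) (E (Suc n)) (s n)" by metis
  have s: "\<And>n. s n \<in> Hom C (E n) (E (Suc n))"
    and s_mono: "\<And>n x. x \<in> Hom C T (E n) \<Longrightarrow> s n \<cdot> x = Zero C T (E (Suc n)) \<Longrightarrow> x = Zero C T (E n)"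
    using R unfolding R_def by blast+
  have nat: "small \<kappa> (UNIV :: nat set)" using size by (rule small_nat)
  note EO = aisle_shift_Ob[OF E]
  obtain S \<iota> where S: "is_coproduct C UNIV E S \<iota>"
    by (rule ex_small_coproduct[OF size coproducts nat, of E]) (use EO in auto)
  note \<iota> = is_coproductD(2)[OF S UNIV_I] and SO = is_coproductD(1)[OF S]
  have "\<exists>d. d \<in> Hom C S S \<and> (\<forall>n. d \<cdot> \<iota> n = Add C (\<iota> n) (Neg C (\<iota> (Suc n) \<cdot> s n)))"
    by (rule coproduct_map[OF S SO, of "\<lambda>n. Add C (\<iota> n) (Neg C (\<iota> (Suc n) \<cdot> s n))"])
      (auto intro!: Add_in_Hom Neg_in_Hom \<iota> Comp_in_Hom[OF s \<iota>])
  then obtain d where d: "d \<in> Hom C S S" "\<And>n. d \<cdot> \<iota> n = Add C (\<iota> n) (Neg C (\<iota> (Suc n) \<cdot> s n))"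
    by blast
  interpret telescope C E s S \<iota> d
    by unfold_locales (fact s S d)+
  obtain g h where t: "(d, g, h) \<in> Tri C" using TR1_ex HomD(1)[OF d(1)] by blast
  obtain H where g: "g \<in> Hom C S H" and h: "h \<in> Hom C H (Sh C S)"
    by (rule TriD[OF t]) (use HomD[OF d(1)] in \<open>auto simp: Hom_def\<close>)
  have HO: "H \<in> Ob C" using HomD[OF g] by simp
  have "E n \<in> aisle_shift k" for n using E[of n] aisle_shift_mono[of k "k + int n"] by auto
  then have "S \<in> aisle_shift k" using aisle_shift_coproduct[OF nat S] by blast
  then have H\<omega>: "H \<in> perp C UNIV \<omega>"
    using perp_Sh[of S UNIV \<omega>]
    by (intro perp_cone[OF t g h \<omega>_Ob SO]) (auto simp: aisle_shift_def)
  \<comment> \<open>For large \<open>N\<close> the coproduct of the objects \<open>E n\<close> with \<open>n \<ge> N\<close> is too deep in the aisle to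
    receive a nonzero map from \<open>\<sigma>[j]\<close>.\<close>
  have Q_fin: "\<exists>N. (\<forall>x \<in> Hom C (shift C j \<sigma>) S. trunc N \<cdot> x = Zero C (shift C j \<sigma>) S) \<and>
      (\<forall>n\<ge>N. hom_vanishes C (shift C j \<sigma>) (E n))" for j
  proof -
    define N where "N = nat (j - k + 1)"
    have N: "j < k + int n" if "n \<ge> N" for n using that by (auto simp: N_def)
    have E': "E (n + N) \<in> aisle_shift (k + int N)" for n
      using E[of "n + N"] aisle_shift_mono[of "k + int N" "k + int (n + N)"] by auto
    obtain S' \<tau> where S': "is_coproduct C UNIV (\<lambda>n. E (n + N)) S' \<tau>"
      by (rule ex_small_coproduct[OF size coproducts nat, of "\<lambda>n. E (n + N)"]) (use EO in auto)
    have "S' \<in> aisle_shift (k + int N)" using aisle_shift_coproduct[OF nat S'] E' by blast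
    then have "hom_vanishes C (shift C j \<sigma>) S'" using aisle_shift_vanishes N by blast
    then show ?thesis using trunc_vanishes[OF S'] aisle_shift_vanishes[OF E N] by blast
  qed
  have "hom_vanishes C (shift C j \<sigma>) H" for j
  proof (rule hom_vanishesI[OF shift_in_Ob[OF \<sigma>_Ob] HO])
    let ?Q = "shift C j \<sigma>" and ?Q' = "shift C (j - 1) \<sigma>"
    have QO: "?Q \<in> Ob C" "?Q' \<in> Ob C" using shift_in_Ob[OF \<sigma>_Ob] by auto
    have Q: "?Q = Sh C ?Q'" using shift_minus1[OF \<sigma>_Ob] by simp
    fix x assume x: "x \<in> Hom C ?Q H"
    note hx = Comp_in_Hom[OF x h]
    obtain z where z: "z \<in> Hom C ?Q' S" "h \<cdot> x = ShA C z"
      using ShA_surj[OF QO(2) SO hx[unfolded Q]] .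
    \<comment> \<open>Injectivity of \<open>d\<close> on maps from \<open>\<sigma>[j - 1]\<close> gives \<open>h x = 0\<close>; surjectivity on maps from \<open>\<sigma>[j]\<close> then
      gives \<open>x = 0\<close>.\<close>
    have Sd: "ShA C d \<in> Hom C (Sh C S) (Sh C S)" using ShA_in_Hom[OF d(1)] .
    have "Neg C (ShA C d) \<cdot> h = Zero C H (Sh C S)"
      using Tri_comp_zero[OF Tri_rotate[OF Tri_rotate[OF t]] h Neg_in_Hom[OF Sd]] .
    then have "ShA C d \<cdot> h = Zero C H (Sh C S)"
      using Comp_Neg_left[OF h Sd] Neg_Neg[OF Comp_in_Hom[OF h Sd]] Neg_Zero[OF HO Sh_in_Ob[OF SO]] by simp
    then have "ShA C (d \<cdot> z) = Zero C ?Q (Sh C S)"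
      using ShA_Comp[OF z(1) d(1)] z(2) Comp_assoc[OF x h Sd] Comp_Zero_left[OF x Sh_in_Ob[OF SO]] by simp
    then have "d \<cdot> z = Zero C ?Q' S"
      using ShA_Zero[OF QO(2) SO] Q ShA_inj[OF Comp_in_Hom[OF z(1) d(1)] Zero_in_Hom[OF QO(2) SO]] by simp
    then have "z = Zero C ?Q' S" using Q_fin[of "j - 1"] d_inj[OF z(1)] z(1) by blast
    then have "h \<cdot> x = Zero C ?Q (Sh C S)" using z(2) ShA_Zero[OF QO(2) SO] Q by simp
    then obtain y where y: "y \<in> Hom C ?Q S" "g \<cdot> y = x"
      using Tri_exact_right[OF Tri_rotate[OF t] g h x] by blast
    obtain N where N: "trunc N \<cdot> y = Zero C ?Q S" "\<And>n. n \<ge> N \<Longrightarrow> hom_vanishes C ?Q (E n)"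
      using Q_fin[of j] y(1) by blast
    obtain w where w: "w \<in> Hom C ?Q S" "d \<cdot> w = y" using d_surj[OF y(1) N] .
    have "x = (g \<cdot> d) \<cdot> w" using y(2) w(2) Comp_assoc[OF w(1) d(1) g] by simp
    then show "x = Zero C ?Q H"
      using Tri_comp_zero[OF t d(1) g] Comp_Zero_left[OF w(1) HO] by simp
  qed
  from this[of "- j" for j] have H\<sigma>: "H \<in> perp C UNIV \<sigma>"
    using hom_vanishes_shift[OF \<sigma>_Ob HO, of "- j" 0 for j] HO by (simp add: perp_def)
  have "Id C H = Zero C H H"
    using hom_vanishesD[OF \<sigma>_generates[OF H\<omega> H\<sigma>] Id_in_Hom[OF HO]] .
  then have TH: "x = Zero C T H" if "x \<in> Hom C T H" for x
    using Id_left[OF that] Comp_Zero_left[OF that HO] by simp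
  have f': "f \<in> Hom C T (E 0)" using f E_0 by simp
  obtain y where y: "y \<in> Hom C T S" "d \<cdot> y = \<iota> 0 \<cdot> f"
    using Tri_exact_right[OF t d(1) g Comp_in_Hom[OF f' \<iota>] TH[OF Comp_in_Hom[OF Comp_in_Hom[OF f' \<iota>] g]]] .
  obtain N where "trunc N \<cdot> y = Zero C T S" using trunc_compact[OF size T_compact y(1)] by blast
  then show "f = Zero C T E0" using d_image_\<iota>_0[OF f' y _ s_mono] E_0 by blast
qed

text \<open>
  The borderline degree \<open>p = 1\<close>: the cone of the approximation is still invisible to \<open>T\<close>, so a map \<open>T \<rightarrow> E\<close> comes
  from a finite sum of maps \<open>T \<rightarrow> \<sigma>[1]\<close>.
\<close>

lemma T_factors:
  assumes E: "E \<in> aisle_shift 1" and f: "f \<in> Hom C T E"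
    and \<alpha>: "\<alpha> \<in> Hom C T N" "\<And>a. a \<in> Hom C T (shift C 1 \<sigma>) \<Longrightarrow> \<exists>u \<in> Hom C N (shift C 1 \<sigma>). u \<cdot> \<alpha> = a"
  obtains u where "u \<in> Hom C N E" "u \<cdot> \<alpha> = f"
proof -
  obtain J :: "'m set" and F \<iota> \<phi> E' s h where J: "small \<kappa> J"
    and F: "is_coproduct C J (\<lambda>_. shift C 1 \<sigma>) F \<iota>" and t: "(\<phi>, s, h) \<in> Tri C"
    and \<phi>: "\<phi> \<in> Hom C F E" and s: "s \<in> Hom C E E'" and E': "E' \<in> aisle_shift (1 + 1)"
    using approximation[OF E] .
  have NO: "N \<in> Ob C" using HomD[OF \<alpha>(1)] by simp
  have "hom_vanishes C T E'" using T_vanishes[OF E'] by simp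
  then have "s \<cdot> f = Zero C T E'" using Comp_in_Hom[OF f s] hom_vanishesD by blast
  then obtain y where y: "y \<in> Hom C T F" "\<phi> \<cdot> y = f" using Tri_exact_right[OF t \<phi> s f] by blast
  have "\<exists>u \<in> Hom C N F. u \<cdot> \<alpha> = y"
  proof (rule compact_induct[OF size T_compact J shift_in_Ob[OF \<sigma>_Ob] F y(1)])
    show "\<exists>u \<in> Hom C N F. u \<cdot> \<alpha> = Zero C T F"
      using Comp_Zero_left[OF \<alpha>(1)] Zero_in_Hom[OF NO] is_coproductD(1)[OF F] by blast
    show "\<exists>u \<in> Hom C N F. u \<cdot> \<alpha> = Add C x x'"
      if ex: "\<exists>u \<in> Hom C N F. u \<cdot> \<alpha> = x" "\<exists>u \<in> Hom C N F. u \<cdot> \<alpha> = x'" for x x'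
    proof -
      obtain u u' where u: "u \<in> Hom C N F" "u \<cdot> \<alpha> = x" "u' \<in> Hom C N F" "u' \<cdot> \<alpha> = x'"
        using ex by blast
      show ?thesis using Comp_Add_left[OF \<alpha>(1) u(1,3)] u Add_in_Hom[OF u(1,3)] by metis
    qed
    show "\<exists>u \<in> Hom C N F. u \<cdot> \<alpha> = \<iota> i \<cdot> a" if i: "i \<in> J" and a: "a \<in> Hom C T (shift C 1 \<sigma>)" for i a
    proof -
      obtain u where u: "u \<in> Hom C N (shift C 1 \<sigma>)" "u \<cdot> \<alpha> = a" using \<alpha>(2)[OF a] by blast
      note \<iota> = is_coproductD(2)[OF F i]
      have "(\<iota> i \<cdot> u) \<cdot> \<alpha> = \<iota> i \<cdot> a" using Comp_assoc[OF \<alpha>(1) u(1) \<iota>] u(2) by simp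
      then show ?thesis using Comp_in_Hom[OF u(1) \<iota>] by blast
    qed
  qed
  then obtain u where u: "u \<in> Hom C N F" "u \<cdot> \<alpha> = y" by blast
  have "(\<phi> \<cdot> u) \<cdot> \<alpha> = f" using Comp_assoc[OF \<alpha>(1) u(1) \<phi>] u(2) y(2) by simp
  then show ?thesis using that Comp_in_Hom[OF u(1) \<phi>] by blast
qed

end

section \<open>Orthogonals under functors, adjunctions and full subcategories\<close>

lemma is_functorD:
  assumes "is_functor C D F"
  shows "\<And>A. A \<in> Ob C \<Longrightarrow> FOb F A \<in> Ob D"
    and "\<And>A B f. f \<in> Hom C A B \<Longrightarrow> FAr F f \<in> Hom D (FOb F A) (FOb F B)"
    and "\<And>A. A \<in> Ob C \<Longrightarrow> FAr F (Id C A) = Id D (FOb F A)"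
    and "\<And>A B E f g. f \<in> Hom C A B \<Longrightarrow> g \<in> Hom C B E \<Longrightarrow> FAr F (g \<cdot>\<^bsub>C\<^esub> f) = FAr F g \<cdot>\<^bsub>D\<^esub> FAr F f"
  using assms unfolding is_functor_def by blast+

lemma adjunction_hom_vanishes:
  assumes C: "additive_category C" and D: "additive_category D" and adj: "adjunction C D F G \<eta> \<epsilon>"
    and A: "A \<in> Ob C" and B: "B \<in> Ob D"
  shows "hom_vanishes D (FOb F A) B \<longleftrightarrow> hom_vanishes C A (FOb G B)"
proof -
  interpret C: additive_category C by fact
  interpret D: additive_category D by fact
  have F: "is_functor C D F" and G: "is_functor D C G" using adj by (auto simp: adjunction_def)
  note F = is_functorD[OF F] and G = is_functorD[OF G]
  have \<eta>: "\<And>A. A \<in> Ob C \<Longrightarrow> \<eta> A \<in> Hom C A (FOb G (FOb F A))"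
    and \<epsilon>: "\<And>B. B \<in> Ob D \<Longrightarrow> \<epsilon> B \<in> Hom D (FOb F (FOb G B)) B"
    and nat_\<eta>: "\<And>A A' f. f \<in> Hom C A A' \<Longrightarrow> FAr G (FAr F f) \<cdot>\<^bsub>C\<^esub> \<eta> A = \<eta> A' \<cdot>\<^bsub>C\<^esub> f"
    and nat_\<epsilon>: "\<And>B B' g. g \<in> Hom D B B' \<Longrightarrow> g \<cdot>\<^bsub>D\<^esub> \<epsilon> B = \<epsilon> B' \<cdot>\<^bsub>D\<^esub> FAr F (FAr G g)"
    and tri1: "\<epsilon> (FOb F A) \<cdot>\<^bsub>D\<^esub> FAr F (\<eta> A) = Id D (FOb F A)"
    and tri2: "FAr G (\<epsilon> B) \<cdot>\<^bsub>C\<^esub> \<eta> (FOb G B) = Id C (FOb G B)"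
    using adj A B unfolding adjunction_def by blast+
  have FA: "FOb F A \<in> Ob D" and GB: "FOb G B \<in> Ob C" using F(1) A G(1) B by auto
  have right: "f = FAr G (\<epsilon> B \<cdot>\<^bsub>D\<^esub> FAr F f) \<cdot>\<^bsub>C\<^esub> \<eta> A" if f: "f \<in> Hom C A (FOb G B)" for f
  proof -
    have "FAr G (\<epsilon> B \<cdot>\<^bsub>D\<^esub> FAr F f) \<cdot>\<^bsub>C\<^esub> \<eta> A = (FAr G (\<epsilon> B) \<cdot>\<^bsub>C\<^esub> FAr G (FAr F f)) \<cdot>\<^bsub>C\<^esub> \<eta> A"
      using G(4)[OF F(2)[OF f] \<epsilon>[OF B]] by simp
    also have "\<dots> = FAr G (\<epsilon> B) \<cdot>\<^bsub>C\<^esub> (\<eta> (FOb G B) \<cdot>\<^bsub>C\<^esub> f)"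
      using C.Comp_assoc[OF \<eta>[OF A] G(2)[OF F(2)[OF f]] G(2)[OF \<epsilon>[OF B]]] nat_\<eta>[OF f] by simp
    also have "\<dots> = f"
      using C.Comp_assoc[OF f \<eta>[OF GB] G(2)[OF \<epsilon>[OF B]]] tri2 C.Id_left[OF f] by simp
    finally show ?thesis by simp
  qed
  have left: "f = \<epsilon> B \<cdot>\<^bsub>D\<^esub> FAr F (FAr G f \<cdot>\<^bsub>C\<^esub> \<eta> A)" if f: "f \<in> Hom D (FOb F A) B" for f
  proof -
    have "\<epsilon> B \<cdot>\<^bsub>D\<^esub> FAr F (FAr G f \<cdot>\<^bsub>C\<^esub> \<eta> A) = \<epsilon> B \<cdot>\<^bsub>D\<^esub> (FAr F (FAr G f) \<cdot>\<^bsub>D\<^esub> FAr F (\<eta> A))"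
      using F(4)[OF \<eta>[OF A] G(2)[OF f]] by simp
    also have "\<dots> = (f \<cdot>\<^bsub>D\<^esub> \<epsilon> (FOb F A)) \<cdot>\<^bsub>D\<^esub> FAr F (\<eta> A)"
      using D.Comp_assoc[OF F(2)[OF \<eta>[OF A]] F(2)[OF G(2)[OF f]] \<epsilon>[OF B]] nat_\<epsilon>[OF f] by simp
    also have "\<dots> = f"
      using D.Comp_assoc[OF F(2)[OF \<eta>[OF A]] \<epsilon>[OF FA] f] tri1 D.Id_right[OF f] by simp
    finally show ?thesis by simp
  qed
  show ?thesis
  proof
    assume v: "hom_vanishes D (FOb F A) B"
    show "hom_vanishes C A (FOb G B)"
    proof (rule C.hom_vanishesI[OF A GB])
      fix f assume f: "f \<in> Hom C A (FOb G B)"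
      have z: "Zero C A (FOb G B) \<in> Hom C A (FOb G B)" using A GB by (rule C.Zero_in_Hom)
      have "\<epsilon> B \<cdot>\<^bsub>D\<^esub> FAr F k = Zero D (FOb F A) B" if "k \<in> Hom C A (FOb G B)" for k
        using D.hom_vanishesD[OF v D.Comp_in_Hom[OF F(2)[OF that] \<epsilon>[OF B]]] .
      then show "f = Zero C A (FOb G B)" using right[OF f] right[OF z] f z by simp
    qed
  next
    assume v: "hom_vanishes C A (FOb G B)"
    show "hom_vanishes D (FOb F A) B"
    proof (rule D.hom_vanishesI[OF FA B])
      fix f assume f: "f \<in> Hom D (FOb F A) B"
      have z: "Zero D (FOb F A) B \<in> Hom D (FOb F A) B" using FA B by (rule D.Zero_in_Hom)
      have "FAr G k \<cdot>\<^bsub>C\<^esub> \<eta> A = Zero C A (FOb G B)" if "k \<in> Hom D (FOb F A) B" for k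
        using C.hom_vanishesD[OF v C.Comp_in_Hom[OF \<eta>[OF A] G(2)[OF that]]] .
      then show "f = Zero D (FOb F A) B" using left[OF f] left[OF z] f z by simp
    qed
  qed
qed

lemma fully_faithful_hom_vanishes:
  assumes C: "additive_category C" and D: "additive_category D" and F: "is_functor C D F"
    and ff: "fully_faithful C D F" and A: "A \<in> Ob C" and B: "B \<in> Ob C"
  shows "hom_vanishes D (FOb F A) (FOb F B) \<longleftrightarrow> hom_vanishes C A B"
proof -
  interpret C: additive_category C by fact
  interpret D: additive_category D by fact
  have b: "bij_betw (FAr F) (Hom C A B) (Hom D (FOb F A) (FOb F B))"
    using ff A B by (simp add: fully_faithful_def)
  have z: "Zero C A B \<in> Hom C A B" using A B by (rule C.Zero_in_Hom)
  have z': "Zero D (FOb F A) (FOb F B) \<in> Hom D (FOb F A) (FOb F B)"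
    using is_functorD(1)[OF F] A B by (intro D.Zero_in_Hom)
  show ?thesis
  proof
    assume v: "hom_vanishes D (FOb F A) (FOb F B)"
    show "hom_vanishes C A B"
    proof (rule C.hom_vanishesI[OF A B])
      fix f assume f: "f \<in> Hom C A B"
      have "FAr F f = FAr F (Zero C A B)"
        using D.hom_vanishesD[OF v is_functorD(2)[OF F f]] D.hom_vanishesD[OF v is_functorD(2)[OF F z]] by simp
      then show "f = Zero C A B" using b f z by (auto simp: bij_betw_def dest: inj_onD)
    qed
  next
    assume "hom_vanishes C A B"
    then have "Hom D (FOb F A) (FOb F B) = {FAr F (Zero C A B)}"
      using b by (auto simp: bij_betw_def hom_vanishes_def)
    then show "hom_vanishes D (FOb F A) (FOb F B)" using z' by (auto simp: hom_vanishes_def)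
  qed
qed

context triangulated_category
begin

lemma isomorphic_Sh:
  assumes "isomorphic C A B"
  shows "isomorphic C (Sh C A) (Sh C B)"
proof -
  obtain f g where f: "f \<in> Hom C A B" "g \<in> Hom C B A" "g \<cdot> f = Id C A" "f \<cdot> g = Id C B"
    using assms by (rule isomorphicE)
  show ?thesis
    by (rule isomorphicI[OF ShA_in_Hom[OF f(1)] ShA_in_Hom[OF f(2)]])
      (use ShA_Comp[OF f(1,2)] ShA_Comp[OF f(2,1)] ShA_Id HomD[OF f(1)] f in simp_all)
qed

lemma isomorphic_unSh:
  assumes "isomorphic C (Sh C A) (Sh C B)" and A: "A \<in> Ob C" and B: "B \<in> Ob C"
  shows "isomorphic C A B"
proof -
  obtain f g where f: "f \<in> Hom C (Sh C A) (Sh C B)" "g \<in> Hom C (Sh C B) (Sh C A)"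
    "g \<cdot> f = Id C (Sh C A)" "f \<cdot> g = Id C (Sh C B)"
    using assms(1) by (rule isomorphicE)
  obtain f' where f': "f' \<in> Hom C A B" "f = ShA C f'" using ShA_surj[OF A B f(1)] .
  obtain g' where g': "g' \<in> Hom C B A" "g = ShA C g'" using ShA_surj[OF B A f(2)] .
  show ?thesis
  proof (rule isomorphicI[OF f'(1) g'(1)])
    show "g' \<cdot> f' = Id C A"
      using ShA_inj[OF Comp_in_Hom[OF f'(1) g'(1)] Id_in_Hom[OF A]] ShA_Comp[OF f'(1) g'(1)] ShA_Id[OF A]
        f f' g' by simp
    show "f' \<cdot> g' = Id C B"
      using ShA_inj[OF Comp_in_Hom[OF g'(1) f'(1)] Id_in_Hom[OF B]] ShA_Comp[OF g'(1) f'(1)] ShA_Id[OF B]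
        f f' g' by simp
  qed
qed

text \<open>The arrows are the shifted ones up to sign; only their sources and targets are needed.\<close>

lemma Tri_shift:
  assumes t: "(f, g, h) \<in> Tri C" and f: "f \<in> Hom C A B" and g: "g \<in> Hom C B D"
  shows "\<exists>f g h. (f, g, h) \<in> Tri C \<and> f \<in> Hom C (shift C (int n) A) (shift C (int n) B) \<and>
    g \<in> Hom C (shift C (int n) B) (shift C (int n) D) \<and>
    h \<in> Hom C (shift C (int n) D) (Sh C (shift C (int n) A))"
proof (induction n)
  case 0
  have "h \<in> Hom C D (Sh C A)" by (rule TriD[OF t]) (use HomD[OF f] HomD[OF g] in \<open>simp add: Hom_def\<close>)
  then show ?case using t f g by auto
next
  case (Suc n)
  then obtain f' g' h' where t': "(f', g', h') \<in> Tri C"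
    and f': "f' \<in> Hom C (shift C (int n) A) (shift C (int n) B)"
    and g': "g' \<in> Hom C (shift C (int n) B) (shift C (int n) D)"
    and h': "h' \<in> Hom C (shift C (int n) D) (Sh C (shift C (int n) A))" by blast
  have Ob: "A \<in> Ob C" "B \<in> Ob C" "D \<in> Ob C" using HomD[OF f] HomD[OF g] by simp_all
  have e: "shift C (int (Suc n)) W = Sh C (shift C (int n) W)" if "W \<in> Ob C" for W
    using shift_plus1[OF that, of "int n"] by (simp add: add.commute)
  show ?case
    unfolding e[OF Ob(1)] e[OF Ob(2)] e[OF Ob(3)]
    using Tri_rotate[OF Tri_rotate[OF Tri_rotate[OF t']]] Neg_in_Hom[OF ShA_in_Hom[OF f']]
      Neg_in_Hom[OF ShA_in_Hom[OF g']] Neg_in_Hom[OF ShA_in_Hom[OF h']] by blast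
qed

lemma perp_isomorphic_shift:
  assumes "A \<in> Ob C" "B \<in> Ob C" "\<And>k. isomorphic C (B' k) (shift C k B)"
  shows "B \<in> perp C I A \<longleftrightarrow> (\<forall>k\<in>I. hom_vanishes C A (B' k))"
  using hom_vanishes_isomorphic[OF assms(3,1)] assms(2) by (simp add: perp_def)

lemma is_zero_perp:
  assumes "is_zero C B" "A \<in> Ob C"
  shows "B \<in> perp C I A"
proof -
  have B: "B \<in> Ob C" using assms(1) by (simp add: is_zero_def)
  have "hom_vanishes C A (shift C k B)" for k
    using hom_vanishes_shift[OF assms(2) B, of "- k" 0] shift_in_Ob[OF assms(2)] assms(1)
    by (simp add: is_zero_def)
  then show ?thesis using B by (simp add: perp_def)
qed

lemma perp_direct_sum:
  assumes "direct_sum C A B S"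
  shows "perp C I S = perp C I A \<inter> perp C I B"
  using hom_vanishes_direct_sum[OF assms shift_in_Ob] by (auto simp: perp_def)

text \<open>A silting object \<open>M\<close> is a retract of its aisle part, because its map to the coaisle part is zero.\<close>

lemma silting_self:
  assumes "silting C M"
  shows "M \<in> perp C {0<..} M"
proof -
  have M: "M \<in> Ob C" and tp: "torsion_pair C (perp C {0<..} M) (perp C {..0} M)"
    using assms by (auto simp: silting_def t_structure_def)
  have "\<exists>(f, g, h) \<in> Tri C. Dom C f \<in> perp C {0<..} M \<and> Cod C f = M \<and> Cod C g \<in> perp C {..0} M"
    using tp M unfolding torsion_pair_def by blast
  then obtain f g h where t: "(f, g, h) \<in> Tri C" and fg: "Dom C f \<in> perp C {0<..} M"
    "Cod C f = M" "Cod C g \<in> perp C {..0} M" by blast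
  obtain U V where f: "f \<in> Hom C U M" and g: "g \<in> Hom C M V"
    by (rule TriD[OF t]) (use fg(2) in \<open>auto simp: Hom_def\<close>)
  have U: "U \<in> perp C {0<..} M" and V: "V \<in> perp C {..0} M"
    using fg HomD[OF f] HomD[OF g] by auto
  have "hom_vanishes C M (shift C 0 V)" using V unfolding perp_def by blast
  then have gI: "g \<cdot> Id C M = Zero C M V" using Id_right[OF g] hom_vanishesD[OF _ g] by simp
  obtain s where s: "s \<in> Hom C M U" "f \<cdot> s = Id C M"
    using Tri_exact_right[OF t f g Id_in_Hom[OF M] gI] .
  have "hom_vanishes C M (shift C k M)" if "k > 0" for k
  proof -
    have v: "hom_vanishes C M (shift C k W) \<longleftrightarrow> hom_vanishes C (shift C (- k) M) W" if "W \<in> Ob C" for W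
      using hom_vanishes_shift[OF M that, of "- k" 0] by simp
    have "hom_vanishes C (shift C (- k) M) U"
      using v[of U] U that by (simp add: perp_def)
    then show ?thesis
      using v[OF M] hom_vanishes_retract[OF s(1) f s(2) shift_in_Ob[OF M]] by blast
  qed
  then show ?thesis using M by (simp add: perp_def)
qed

end

lemma triangle_functor_Sh:
  assumes "triangle_functor C D F" "A \<in> Ob C"
  shows "isomorphic D (FOb F (Sh C A)) (Sh D (FOb F A))"
  using assms unfolding triangle_functor_def isomorphic_def by blast

lemma triangle_functor_shift:
  assumes C: "triangulated_category C" and D: "triangulated_category D"
    and F: "triangle_functor C D F" and A: "A \<in> Ob C"
  shows "isomorphic D (FOb F (shift C k A)) (shift D k (FOb F A))"
proof -
  interpret C: triangulated_category C by fact
  interpret D: triangulated_category D by fact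
  have func: "is_functor C D F" using F by (simp add: triangle_functor_def)
  note FOb = is_functorD(1)[OF func]
  note FA = FOb[OF A]
  show ?thesis
  proof (induction k rule: int_induct[where k = 0])
    case base
    show ?case using D.isomorphic_refl[OF FA] by simp
  next
    case (step1 i)
    have "isomorphic D (FOb F (Sh C (shift C i A))) (Sh D (FOb F (shift C i A)))"
      by (rule triangle_functor_Sh[OF F C.shift_in_Ob[OF A]])
    then have "isomorphic D (FOb F (Sh C (shift C i A))) (Sh D (shift D i (FOb F A)))"
      using D.isomorphic_Sh[OF step1(2)] by (rule D.isomorphic_trans)
    then show ?case
      using C.shift_plus1[OF A] D.shift_plus1[OF FA] by simp
  next
    case (step2 i)
    have "isomorphic D (Sh D (FOb F (shift C (i - 1) A))) (FOb F (Sh C (shift C (i - 1) A)))"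
      by (rule D.isomorphic_sym[OF triangle_functor_Sh[OF F C.shift_in_Ob[OF A]]])
    then have "isomorphic D (Sh D (FOb F (shift C (i - 1) A))) (Sh D (shift D (i - 1) (FOb F A)))"
      using D.isomorphic_trans[of _ _ "shift D i (FOb F A)"] step2(2)
      by (simp add: C.shift_minus1[OF A] D.shift_minus1[OF FA])
    then show ?case
      using D.isomorphic_unSh FOb[OF C.shift_in_Ob[OF A]] D.shift_in_Ob[OF FA] by blast
  qed
qed

lemma perp_adjoint:
  assumes C: "triangulated_category C" and D: "triangulated_category D"
    and G: "triangle_functor D C G" and adj: "adjunction C D F G \<eta> \<epsilon>"
    and A: "A \<in> Ob C" and B: "B \<in> Ob D"
  shows "FOb G B \<in> perp C I A \<longleftrightarrow> B \<in> perp D I (FOb F A)"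
proof -
  interpret C: triangulated_category C by fact
  interpret D: triangulated_category D by fact
  have GB: "FOb G B \<in> Ob C" using is_functorD(1) G B by (auto simp: triangle_functor_def)
  have "hom_vanishes D (FOb F A) (shift D k B) \<longleftrightarrow> hom_vanishes C A (FOb G (shift D k B))" for k
    using adjunction_hom_vanishes[OF C.additive_category_axioms D.additive_category_axioms adj A D.shift_in_Ob[OF B]] .
  then show ?thesis
    using C.perp_isomorphic_shift[OF A GB triangle_functor_shift[OF D C G B]] B by (simp add: perp_def)
qed

lemma perp_fully_faithful:
  assumes C: "triangulated_category C" and D: "triangulated_category D"
    and F: "triangle_functor C D F" and ff: "fully_faithful C D F"
    and A: "A \<in> Ob C" and B: "B \<in> Ob C"
  shows "FOb F B \<in> perp D I (FOb F A) \<longleftrightarrow> B \<in> perp C I A"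
proof -
  interpret C: triangulated_category C by fact
  interpret D: triangulated_category D by fact
  have func: "is_functor C D F" using F by (simp add: triangle_functor_def)
  have Ob: "FOb F A \<in> Ob D" "FOb F B \<in> Ob D" using is_functorD(1)[OF func] A B by auto
  have "hom_vanishes D (FOb F A) (FOb F (shift C k B)) \<longleftrightarrow> hom_vanishes C A (shift C k B)" for k
    using fully_faithful_hom_vanishes[OF C.additive_category_axioms D.additive_category_axioms func ff A C.shift_in_Ob[OF B]] .
  then show ?thesis
    using D.perp_isomorphic_shift[OF Ob triangle_functor_shift[OF C D F B]] B by (simp add: perp_def)
qed

lemma full_subcategory_simps:
  "Ob (full_subcategory C \<S>) = Ob C \<inter> \<S>"
  "Sh (full_subcategory C \<S>) = Sh C"
  "Zero (full_subcategory C \<S>) = Zero C"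
  by (simp_all add: full_subcategory_def Let_def)

lemma Hom_full_subcategory:
  assumes "A \<in> \<S>" "B \<in> \<S>"
  shows "Hom (full_subcategory C \<S>) A B = Hom C A B"
  using assms by (auto simp: full_subcategory_def Let_def Hom_def)

lemma hom_vanishes_full_subcategory:
  assumes "A \<in> \<S>" "B \<in> \<S>"
  shows "hom_vanishes (full_subcategory C \<S>) A B \<longleftrightarrow> hom_vanishes C A B"
  by (simp add: hom_vanishes_def full_subcategory_simps Hom_full_subcategory[OF assms])

lemma shift_full_subcategory:
  assumes C: "triangulated_category C" and S: "triangulated_category (full_subcategory C \<S>)"
    and A: "A \<in> Ob C \<inter> \<S>"
  shows "shift (full_subcategory C \<S>) k A = shift C k A"
proof -
  interpret C: triangulated_category C by fact
  interpret S: triangulated_category "full_subcategory C \<S>" by fact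
  note [simp] = full_subcategory_simps
  have AS: "A \<in> Ob (full_subcategory C \<S>)" and AC: "A \<in> Ob C" using A by auto
  show ?thesis
  proof (induction k rule: int_induct[where k = 0])
    case base
    show ?case by simp
  next
    case (step1 i)
    then show ?case using S.shift_plus1[OF AS] C.shift_plus1[OF AC] by simp
  next
    case (step2 i)
    have Ob: "shift (full_subcategory C \<S>) (i - 1) A \<in> Ob C" using S.shift_in_Ob[OF AS] by simp
    show ?case
      using C.Sh_inj[OF Ob C.shift_in_Ob[OF AC]] S.shift_minus1[OF AS] C.shift_minus1[OF AC] step2 by simp
  qed
qed

lemma perp_full_subcategory:
  assumes C: "triangulated_category C" and S: "triangulated_category (full_subcategory C \<S>)"
    and A: "A \<in> Ob C \<inter> \<S>"
  shows "perp (full_subcategory C \<S>) I A = perp C I A \<inter> \<S>"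
proof -
  interpret S: triangulated_category "full_subcategory C \<S>" by fact
  have "hom_vanishes (full_subcategory C \<S>) A (shift (full_subcategory C \<S>) k B) \<longleftrightarrow>
      hom_vanishes C A (shift C k B)" if B: "B \<in> Ob C \<inter> \<S>" for B k
  proof -
    have "shift C k B \<in> \<S>"
      using S.shift_in_Ob[of B k] shift_full_subcategory[OF C S B] B by (simp add: full_subcategory_simps)
    then show ?thesis
      using A by (simp add: hom_vanishes_full_subcategory shift_full_subcategory[OF C S B])
  qed
  then show ?thesis by (auto simp: perp_def full_subcategory_simps)
qed

lemma (in triangulated_category) Loc_generator:
  "M \<in> Loc \<kappa> C M"
  by (auto simp: Loc_def)

section \<open>The glued t-structure\<close>

theorem theorem2p17:
  fixes \<kappa> :: "'u rel"
    and D X Y :: "('o, 'm) tricategory"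
    and \<omega> \<sigma> P \<sigma>' \<rho> :: 'o
    and iU iL iS jS jU jL jR iR :: "('o, 'm, 'o, 'm) functr"
    and I :: "'i set" and pr :: "'i \<Rightarrow> 'm" and \<alpha> :: 'm
    and D' D'' :: "'o set"
  assumes size: "size_cardinal \<kappa>"
    and D: "well_generated \<kappa> D"
    and \<omega>: "partial_silting \<kappa> D \<omega>"
    and Y: "Y = full_subcategory D (perp D UNIV \<omega>)"
    and X: "X = full_subcategory D (Loc \<kappa> D \<omega>)"
    and recollement: "recollement Y D X iU iL iS jS jU jL"
    and iL: "iL = inclusion_functor"
    and jS: "jS = inclusion_functor"
    and \<sigma>: "silting Y \<sigma>"
    and I: "finite I"
    and power: "is_product D I (\<lambda>_. FOb iL \<sigma>) P pr"
    and \<alpha>: "preenvelope D (add_closure D (shift D 1 (FOb iL \<sigma>))) (FOb jL \<omega>) (shift D 1 P) \<alpha>"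
    and cond1: "closed_under_coproducts \<kappa> D (perp D {0<..} (FOb iL \<sigma>))"
    and cond2: "\<And>k::int. k \<ge> 2 \<Longrightarrow> hom_vanishes D (FOb jL \<omega>) (shift D k (FOb iL \<sigma>))"
    and cond3: "compact_object \<kappa> D (FOb jL \<omega>)"
    and \<sigma>': "is_cocone D \<alpha> \<sigma>'"
    and \<rho>: "direct_sum D \<sigma>' (FOb iL \<sigma>) \<rho>"
    and lower: "recollement X D Y jU jL jR iL iS iR"
    and D': "D' = {Z \<in> Ob D. FOb jU Z \<in> perp X {0<..} \<omega> \<and> FOb iS Z \<in> perp Y {0<..} \<sigma>}"
    and D'': "D'' = {Z \<in> Ob D. FOb jR Z \<in> perp X {..0} \<omega> \<and> FOb iS Z \<in> perp Y {..0} \<sigma>}"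
  shows "(perp D {0<..} \<rho>, perp D {..0} \<rho>) = (D', D'')"
proof -
  define T where "T = FOb jL \<omega>"
  have inc: "FOb iL A = A" for A
    by (simp add: iL inclusion_functor_def)
  have triD: "triangulated_category D" and triY: "triangulated_category Y" and triX: "triangulated_category X"
    using recollement by (simp_all add: recollement_def)
  interpret triangulated_category D by (fact triD)
  have iS_tri: "triangle_functor D Y iS" and jU_tri: "triangle_functor D X jU"
    and jL_tri: "triangle_functor X D jL" and jL_ff: "fully_faithful X D jL"
    and iS_jL: "\<And>A. A \<in> Ob X \<Longrightarrow> is_zero Y (FOb iS (FOb jL A))"
    using recollement by (simp_all add: recollement_def)
  obtain \<eta>\<^sub>2 \<epsilon>\<^sub>2 \<eta>\<^sub>4 \<epsilon>\<^sub>4 where iL_iS: "adjunction Y D iL iS \<eta>\<^sub>2 \<epsilon>\<^sub>2"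
    and jU_jL: "adjunction D X jU jL \<eta>\<^sub>4 \<epsilon>\<^sub>4"
    and canonical: "\<And>Z. Z \<in> Ob D \<Longrightarrow> \<exists>h. (\<epsilon>\<^sub>2 Z, \<eta>\<^sub>4 Z, h) \<in> Tri D"
    using recollement unfolding recollement_def by blast
  obtain \<eta> \<epsilon> where jL_jR: "adjunction X D jL jR \<eta> \<epsilon>" and jR_tri: "triangle_functor D X jR"
    using lower unfolding recollement_def by blast
  have \<omega>_Ob: "\<omega> \<in> Ob D" using \<omega> by (simp add: partial_silting_def perp_def)
  have \<omega>X: "\<omega> \<in> Ob X" using \<omega>_Ob Loc_generator by (simp add: X full_subcategory_simps)
  have YOb: "Ob Y = perp D UNIV \<omega>" by (auto simp: Y full_subcategory_simps perp_def)
  have \<sigma>Y: "\<sigma> \<in> Ob Y" using \<sigma> by (simp add: silting_def)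
  then have \<sigma>_Ob: "\<sigma> \<in> Ob D" and \<sigma>_in: "\<sigma> \<in> Ob D \<inter> perp D UNIV \<omega>"
    by (auto simp: YOb perp_def)
  have perpY: "perp Y J \<sigma> = perp D J \<sigma> \<inter> Ob Y" for J
    using perp_full_subcategory[OF triD triY[unfolded Y] \<sigma>_in] unfolding YOb by (simp add: Y)
  \<comment> \<open>The defining conditions of the glued t-structure become orthogonality conditions in \<open>D\<close>.\<close>
  have iS_perp: "FOb iS Z \<in> perp Y J \<sigma> \<longleftrightarrow> Z \<in> perp D J \<sigma>" if "Z \<in> Ob D" for Z J
    using perp_adjoint[OF triY triD iS_tri iL_iS \<sigma>Y that] by (simp add: inc)
  have jR_perp: "FOb jR Z \<in> perp X J \<omega> \<longleftrightarrow> Z \<in> perp D J T" if "Z \<in> Ob D" for Z J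
    using perp_adjoint[OF triX triD jR_tri jL_jR \<omega>X that] by (simp add: T_def)
  have jU_perp: "FOb jU Z \<in> perp X J \<omega> \<longleftrightarrow> FOb jL (FOb jU Z) \<in> perp D J T" if "Z \<in> Ob D" for Z J
  proof -
    have "FOb jU Z \<in> Ob X" using jU_tri that is_functorD(1) by (auto simp: triangle_functor_def)
    then show ?thesis using perp_fully_faithful[OF triX triD jL_tri jL_ff \<omega>X] by (simp add: T_def)
  qed
  interpret silting_approximation D \<kappa> \<omega> \<sigma> T
  proof
    show "size_cardinal \<kappa>" by (fact size)
    show "locally_small \<kappa> D" "has_small_coproducts \<kappa> D" using D by (simp_all add: well_generated_def)
    show "\<omega> \<in> Ob D" by (fact \<omega>_Ob)
    show "closed_under_coproducts \<kappa> D (perp D UNIV \<omega>)"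
      using \<omega> by (intro perp_coproducts_all \<omega>_Ob) (simp add: partial_silting_def)
    show "\<sigma> \<in> perp D UNIV \<omega>" using \<sigma>_in by simp
    show "\<sigma> \<in> perp D {0<..} \<sigma>"
      using triangulated_category.silting_self[OF triY \<sigma>] by (simp add: perpY)
    show "closed_under_coproducts \<kappa> D (perp D {0<..} \<sigma>)" using cond1 by (simp add: inc)
    show "hom_vanishes D H H" if H: "H \<in> perp D UNIV \<omega>" "H \<in> perp D UNIV \<sigma>" for H
    proof -
      have "H \<in> perp Y {0<..} \<sigma>" "H \<in> perp Y {..0} \<sigma>"
        unfolding perpY YOb using H by (auto simp: perp_def)
      then have "hom_vanishes Y H H"
        using \<sigma> by (auto simp: silting_def t_structure_def torsion_pair_def)
      then show ?thesis by (simp add: Y hom_vanishes_full_subcategory[OF H(1) H(1)])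
    qed
    show "compact_object \<kappa> D T" using cond3 by (simp add: T_def)
    show "hom_vanishes D T (shift D k \<sigma>)" if "k \<ge> 2" for k using cond2[OF that] by (simp add: inc T_def)
  qed
  define N where "N = shift D 1 P"
  have \<alpha>_Hom: "\<alpha> \<in> Hom D T N" and N_add: "N \<in> add_closure D (shift D 1 \<sigma>)"
    and \<alpha>_fac: "\<And>B f. B \<in> add_closure D (shift D 1 \<sigma>) \<Longrightarrow> f \<in> Hom D T B \<Longrightarrow> \<exists>u \<in> Hom D N B. u \<cdot>\<^bsub>D\<^esub> \<alpha> = f"
    using \<alpha> by (auto simp: preenvelope_def inc T_def N_def)
  have "shift D 1 \<sigma> \<in> add_closure D (shift D 1 \<sigma>)" by (auto simp: add_closure_def)
  note \<alpha>_\<sigma> = \<alpha>_fac[OF this]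
  \<comment> \<open>The object \<open>N\<close> is in \<open>add(\<sigma>[1])\<close>, so it inherits orthogonality from \<open>\<sigma>[1]\<close>.\<close>
  have N_vanishes: "hom_vanishes D N (shift D k W)" if W: "W \<in> Ob D" and v: "hom_vanishes D \<sigma> (shift D (k - 1) W)" for W k
    using hom_vanishes_add_closure[OF N_add _ shift_in_Ob[OF \<sigma>_Ob] shift_in_Ob[OF W]]
      hom_vanishes_shift[OF \<sigma>_Ob W, of 1 k] v by simp
  obtain f h where t: "(f, \<alpha>, h) \<in> Tri D" and dom: "Dom D f = \<sigma>'"
    using \<sigma>' unfolding is_cocone_def by blast
  obtain A where fA: "f \<in> Hom D A T" and hA: "h \<in> Hom D N (Sh D A)"
    by (rule TriD[OF t]) (use HomD[OF \<alpha>_Hom] in \<open>simp add: Hom_def\<close>)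
  then have f: "f \<in> Hom D \<sigma>' T" and h: "h \<in> Hom D N (Sh D \<sigma>')"
    using HomD(2)[OF fA] dom by simp_all
  have \<sigma>'_Ob: "\<sigma>' \<in> Ob D" using HomD[OF f] by simp
  have extend: "\<exists>y \<in> Hom D T (shift D k Z). y \<cdot>\<^bsub>D\<^esub> f = x"
    if Z: "Z \<in> Ob D" "hom_vanishes D \<sigma> (shift D k Z)" and x: "x \<in> Hom D \<sigma>' (shift D k Z)" for x k Z
  proof -
    have "hom_vanishes D N (Sh D (shift D k Z))"
      using N_vanishes[of Z "k + 1"] Z shift_plus1[OF Z(1)] by simp
    then show ?thesis
      using Tri_extend_first[OF t f h x] hom_vanishesD[OF _ Comp_in_Hom[OF h ShA_in_Hom[OF x]]] by blast
  qed
  have \<rho>_perp: "perp D J \<rho> = perp D J \<sigma>' \<inter> perp D J \<sigma>" for J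
    using perp_direct_sum[OF \<rho>] by (simp add: inc)
  have perp_Ob: "perp D J A \<subseteq> Ob D" for J A by (auto simp: perp_def)
  have "Z \<in> perp D {..0} \<sigma>' \<longleftrightarrow> Z \<in> perp D {..0} T" if Z: "Z \<in> Ob D" "Z \<in> perp D {..0} \<sigma>" for Z
  proof -
    have "hom_vanishes D \<sigma>' (shift D k Z) \<longleftrightarrow> hom_vanishes D T (shift D k Z)" if k: "k \<le> 0" for k
    proof
      note W = shift_in_Ob[OF Z(1), of k]
      have v: "hom_vanishes D \<sigma> (shift D k Z)" "hom_vanishes D \<sigma> (shift D (k - 1) Z)"
        using Z(2) k by (simp_all add: perp_def)
      show "hom_vanishes D \<sigma>' (shift D k Z)" if T: "hom_vanishes D T (shift D k Z)"
      proof (rule hom_vanishesI[OF \<sigma>'_Ob W])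
        fix x assume "x \<in> Hom D \<sigma>' (shift D k Z)"
        then obtain y where "y \<in> Hom D T (shift D k Z)" "y \<cdot>\<^bsub>D\<^esub> f = x" using extend[OF Z(1) v(1)] by blast
        then show "x = Zero D \<sigma>' (shift D k Z)"
          using hom_vanishesD[OF T] Comp_Zero_left[OF f W] by blast
      qed
      show "hom_vanishes D T (shift D k Z)" if \<sigma>'v: "hom_vanishes D \<sigma>' (shift D k Z)"
      proof (rule hom_vanishesI[OF T_Ob W])
        fix y assume y: "y \<in> Hom D T (shift D k Z)"
        obtain u where u: "u \<in> Hom D N (shift D k Z)" "u \<cdot>\<^bsub>D\<^esub> \<alpha> = y"
          using Tri_exact_left[OF t f \<alpha>_Hom y hom_vanishesD[OF \<sigma>'v Comp_in_Hom[OF f y]]] .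
        then show "y = Zero D T (shift D k Z)"
          using hom_vanishesD[OF N_vanishes[OF Z(1) v(2)]] Comp_Zero_left[OF \<alpha>_Hom W] by blast
      qed
    qed
    then show ?thesis using Z by (auto simp: perp_def)
  qed
  then have right: "perp D {..0} \<rho> = D''"
    unfolding D'' \<rho>_perp using jR_perp iS_perp perp_Ob by blast
  have "Z \<in> perp D {0<..} \<sigma>' \<longleftrightarrow> FOb jL (FOb jU Z) \<in> perp D {0<..} T"
    if Z: "Z \<in> Ob D" "Z \<in> perp D {0<..} \<sigma>" for Z
  proof -
    define B W where "B = FOb iS Z" and "W = FOb jL (FOb jU Z)"
    obtain h' where t': "(\<epsilon>\<^sub>2 Z, \<eta>\<^sub>4 Z, h') \<in> Tri D" using canonical[OF Z(1)] by blast
    have e2: "\<epsilon>\<^sub>2 Z \<in> Hom D B Z" and n4: "\<eta>\<^sub>4 Z \<in> Hom D Z W"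
      using iL_iS jU_jL Z(1) by (auto simp: adjunction_def inc B_def W_def)
    have WO: "W \<in> Ob D" and BO: "B \<in> Ob D" using HomD[OF e2] HomD[OF n4] by auto
    have "B \<in> perp Y {0<..} \<sigma>" using iS_perp[OF Z(1)] Z(2) by (simp add: B_def)
    then have B: "B \<in> aisle_shift 0" by (simp add: aisle_shift_def perpY YOb)
    have "FOb jU Z \<in> Ob X" using jU_tri Z(1) is_functorD(1) by (auto simp: triangle_functor_def)
    then have W\<sigma>: "W \<in> perp D UNIV \<sigma>"
      using iS_perp[OF WO] triangulated_category.is_zero_perp[OF triY iS_jL \<sigma>Y] by (simp add: W_def)
    have T_B: "hom_vanishes D T (shift D k B)" if "k \<ge> 2" for k
      using T_vanishes[OF shift_aisle[OF B] that] .
    have "hom_vanishes D \<sigma>' (shift D k Z)" if W: "\<And>k. k > 0 \<Longrightarrow> hom_vanishes D T (shift D k W)" and k: "k > 0" for k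
    proof (rule hom_vanishesI[OF \<sigma>'_Ob shift_in_Ob[OF Z(1)]])
      fix x assume x: "x \<in> Hom D \<sigma>' (shift D k Z)"
      have "hom_vanishes D \<sigma> (shift D k Z)" using Z(2) k by (simp add: perp_def)
      then obtain y where y: "y \<in> Hom D T (shift D k Z)" "y \<cdot>\<^bsub>D\<^esub> f = x" using extend[OF Z(1) _ x] by blast
      obtain a b c where tk: "(a, b, c) \<in> Tri D" and a: "a \<in> Hom D (shift D k B) (shift D k Z)"
        and b: "b \<in> Hom D (shift D k Z) (shift D k W)"
        using Tri_shift[OF t' e2 n4, of "nat k"] k by auto
      obtain z where z: "z \<in> Hom D T (shift D k B)" "a \<cdot>\<^bsub>D\<^esub> z = y"
        using Tri_exact_right[OF tk a b y(1) hom_vanishesD[OF W[OF k] Comp_in_Hom[OF y(1) b]]] .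
      \<comment> \<open>In degree \<open>1\<close> the map \<open>z\<close> need not vanish; it factors through \<open>\<alpha>\<close>, and \<open>\<alpha> f = 0\<close>.\<close>
      have zf: "z \<cdot>\<^bsub>D\<^esub> f = Zero D \<sigma>' (shift D k B)"
      proof (cases "k = 1")
        case True
        obtain u where u: "u \<in> Hom D N (shift D k B)" "u \<cdot>\<^bsub>D\<^esub> \<alpha> = z"
          using T_factors[OF shift_aisle[OF B] z(1)[unfolded True] \<alpha>_Hom \<alpha>_\<sigma>] True by blast
        then show ?thesis
          using Comp_assoc[OF f \<alpha>_Hom u(1)] Tri_comp_zero[OF t f \<alpha>_Hom] Comp_Zero_right[OF u(1) \<sigma>'_Ob] by simp
      next
        case False
        then show ?thesis
          using k hom_vanishesD[OF T_B z(1)] Comp_Zero_left[OF f shift_in_Ob[OF BO]] by simp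
      qed
      then show "x = Zero D \<sigma>' (shift D k Z)"
        using y(2) z(2) Comp_assoc[OF f z(1) a] Comp_Zero_right[OF a \<sigma>'_Ob] by simp
    qed
    moreover have "hom_vanishes D T (shift D k W)"
      if \<sigma>'v: "\<And>k. k > 0 \<Longrightarrow> hom_vanishes D \<sigma>' (shift D k Z)" and k: "k > 0" for k
    proof (rule hom_vanishesI[OF T_Ob shift_in_Ob[OF WO]])
      fix x assume x: "x \<in> Hom D T (shift D k W)"
      obtain a b c where tk: "(a, b, c) \<in> Tri D"
        and b: "b \<in> Hom D (shift D k Z) (shift D k W)" and c: "c \<in> Hom D (shift D k W) (Sh D (shift D k B))"
        using Tri_shift[OF t' e2 n4, of "nat k"] k by auto
      have "hom_vanishes D T (Sh D (shift D k B))" using T_B[of "k + 1"] k shift_plus1[OF BO] by simp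
      then have "c \<cdot>\<^bsub>D\<^esub> x = Zero D T (Sh D (shift D k B))" using Comp_in_Hom[OF x c] hom_vanishesD by blast
      then obtain y where y: "y \<in> Hom D T (shift D k Z)" "b \<cdot>\<^bsub>D\<^esub> y = x"
        using Tri_exact_right[OF Tri_rotate[OF tk] b c x] by blast
      obtain u where u: "u \<in> Hom D N (shift D k Z)" "u \<cdot>\<^bsub>D\<^esub> \<alpha> = y"
        using Tri_exact_left[OF t f \<alpha>_Hom y(1) hom_vanishesD[OF \<sigma>'v[OF k] Comp_in_Hom[OF f y(1)]]] .
      have "hom_vanishes D N (shift D k W)" using W\<sigma> WO by (intro N_vanishes) (simp_all add: perp_def)
      then have "b \<cdot>\<^bsub>D\<^esub> u = Zero D N (shift D k W)" using Comp_in_Hom[OF u(1) b] hom_vanishesD by blast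
      then show "x = Zero D T (shift D k W)"
        using y(2) u(2) Comp_assoc[OF \<alpha>_Hom u(1) b] Comp_Zero_left[OF \<alpha>_Hom shift_in_Ob[OF WO]] by simp
    qed
    ultimately show ?thesis using Z(1) WO by (auto simp: perp_def W_def)
  qed
  then have left: "perp D {0<..} \<rho> = D'"
    unfolding D' \<rho>_perp using jU_perp iS_perp perp_Ob by blast
  show ?thesis using left right by simp
qed

end
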